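(* Consider an $\llbracket n,k\rrbracket$ stabilizer code on $m$-dimensional qudits together with a partition $[n]=Q_1\cup\dots\cup Q_N$ of its qudits into disjoint non-empty subsets, with min-distance $d_\downarrow$, max-distance $d_\uparrow$ and disjointness $\Delta$ with respect to this partition. Let $q,h\ge1$ be integers. If $M$ is a positive integer satisfying $$d_\uparrow\,q^{(2^M-1)h}<d_\downarrow\,\Delta^{M-1},$$ then all logical operators implemented by $q$-local circuits of depth $h$ are in the $M$-th level $\overline C_M$ of the Clifford hierarchy of the logical Pauli group.
   Context: Fix a qudit dimension $m\ge2$, $\omega_m=e^{2\pi i/m}$, $X=\sum_{l}|l\oplus1\rangle\langle l|$ (addition mod $m$), $Z=\sum_l\omega_m^l|l\rangle\langle l|$. $\mathcal P_n$ is the group generated by the single-qudit $X$'s and $Z$'s on $n$ qudits (for $m=2$ one may also include $Y=iXZ$ among the generators). The group commutator is $[A,B]=ABA^\dagger B^\dagger$. Stabilizer code: an $\llbracket n,k\rrbracket$ code ($k\ge1$) is given by a group $\mathcal S=\langle s_1,\dots,s_{n-k}\rangle\subseteq\mathcal P_n$ of mutually commuting Paulis with $|\mathcal S|=m^{n-k}$; its code space $\mathcal C\subseteq(\mathbb C^m)^{\otimes n}$ is the simultaneous $+1$ eigenspace of $\mathcal S$, of dimension $m^k$. A logical operator is a unitary on $(\mathbb C^m)^{\otimes n}$ mapping $\mathcal C$ to $\mathcal C$. Logical Pauli generators $\bar X_i,\bar Z_i\in\mathcal P_n$ ($1\le i\le k$) commute with $\mathcal S$ and satisfy $[\bar X_i,\bar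 Z_j]=\omega_m^{-\delta_{ij}}I$, $[\bar X_i,\bar X_j]=[\bar Z_i,\bar Z_j]=I$. The set of non-trivial logical Paulis is the set of cosets $\mathcal L=\{\mathcal S\prod_{i=1}^k\bar X_i^{a_i}\bar Z_i^{a_{i+k}}:a\in\{0,\dots,m-1\}^{2k}\setminus\{0\}\}$. A unitary is transversal with respect to a partition if it is a tensor product of unitaries each acting only on one subset of the partition. $\mathrm{supp}(U)\subseteq[N]$ is the set of $i$ such that $U$ acts non-trivially (not as a scalar multiple of the identity) on $Q_i$. A unitary is $q$-local of depth one (with respect to $\{Q_i\}$) if it is transversal with respect to some coarse-grained partition $\{R_j\}$ in which each $R_j$ is a union of at most $q$ of the $Q_i$. A $q$-local unitary (circuit) of depth $h$ is a product of $h$ $q$-local unitaries of depth one (the coarse-grained partitions may differ between factors; no geometric locality is assumed). Distances: $d(G)=\min_{g\in G}|\mathrm{supp}(g)|$, $d_\downarrow=\min_{G\in\mathcal L}d(G)$, $d_\uparrow=\max_{G\in\mathcal L}d(G)$. Disjointness: for an integer $c\ge1$, $A\subseteq G$ is $c$-disjoint if for every $i\in[N]$ at most $c$ elements $a\in A$ have $i\in\mathrm{supp}(a)$; $\Delta_c(G)=\frac1c\max\{|A|:A\subseteq G\ c\text{-disjoint}\}$ and $\Delta=\max_{c\ge1}\min_{G\in\mathcal L}\Delta_c(G)$. Clifford hierarchy: for a Pauli group $\mathcal P$, $C_1(\mathcal P)=\mathcal P$ and $C_M(\mathcal P)=\{U \text{ unitary}:[U,p]\in C_{M-1}(\mathcal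 P)\ \forall p\in\mathcal P\}$, where unitaries are considered up to global phase. A logical operator is in $\overline C_M$ if the $k$-qudit unitary it induces on $\mathcal C$ (identified with $(\mathbb C^m)^{\otimes k}$ via $\bar X_i,\bar Z_i$) lies in $C_M(\mathcal P_k)$ up to global phase. *)

theory Defs
  imports
    "HOL-Analysis.Analysis"
    "HOL-Algebra.Generated_Groups"
    "HOL-Library.Disjoint_Sets"
    "Berlekamp_Zassenhaus.Finite_Field"
begin

section \<open>Operators on many-qudit spaces\<close>

text \<open>
  Qudits are labelled by a finite type \<open>'n\<close>, and the level dimension \<open>m \<ge> 2\<close> is \<open>CARD('m)\<close> for
  \<open>'m :: nontriv\<close>. The computational basis of the space of \<open>n = CARD('n)\<close> qudits is the set of
  functions \<open>'n \<Rightarrow> 'm mod_ring\<close>, so that addition of basis labels is addition modulo \<open>m\<close>. In a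
  matrix entry \<open>U $ f $ g\<close> the index \<open>f\<close> is the row, i.e. the entry is \<open>\<langle>f|U|g\<rangle>\<close>.
\<close>

type_synonym ('n, 'm) state = "(complex, 'n \<Rightarrow> 'm mod_ring) vec"

type_synonym ('n, 'm) op = "(('n, 'm) state, 'n \<Rightarrow> 'm mod_ring) vec"

definition dagger :: "complex ^ 'a ^ 'b \<Rightarrow> complex ^ 'b ^ 'a" where
  "dagger A = (\<chi> i j. cnj (A $ j $ i))"

definition unitary :: "complex ^ 'a ^ 'a \<Rightarrow> bool" where
  "unitary U \<longleftrightarrow> dagger U ** U = mat 1 \<and> U ** dagger U = mat 1"

definition unitary_group :: "(complex ^ 'a ^ 'a) monoid" where
  "unitary_group = \<lparr>carrier = Collect unitary, mult = (**), one = mat 1\<rparr>"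

definition gcomm :: "complex ^ 'a ^ 'a \<Rightarrow> complex ^ 'a ^ 'a \<Rightarrow> complex ^ 'a ^ 'a" where
  "gcomm A B = A ** B ** dagger A ** dagger B"

text \<open>
  Product of a finite family of operators. It is only applied to families whose members commute
  pairwise, for which the result does not depend on the order of the factors.
\<close>

definition comm_prod :: "('i \<Rightarrow> complex ^ 'a ^ 'a) \<Rightarrow> 'i set \<Rightarrow> complex ^ 'a ^ 'a" where
  "comm_prod W I = Finite_Set.fold (\<lambda>i A. W i ** A) (mat 1) I"

text \<open>The operator is of the form \<open>u \<otimes> 1\<close> with \<open>u\<close> an operator on the qudits in \<open>A\<close>.\<close>

definition acts_only_on :: "'n::finite set \<Rightarrow> ('n, 'm::nontriv) op \<Rightarrow> bool" where
  "acts_only_on A U \<longleftrightarrow>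
     (\<exists>u. \<forall>f g. U $ f $ g = (if \<forall>i\<in>-A. f i = g i then u (restrict f A) (restrict g A) else 0))"


section \<open>Pauli groups and the Clifford hierarchy\<close>

definition omega :: "'m::nontriv itself \<Rightarrow> complex" where
  "omega _ = cis (2 * pi / real CARD('m))"

definition pauli_X :: "'n::finite \<Rightarrow> ('n, 'm::nontriv) op" where
  "pauli_X i = (\<chi> f g. if f = g(i := g i + 1) then 1 else 0)"

definition pauli_Z :: "'n::finite \<Rightarrow> ('n, 'm::nontriv) op" where
  "pauli_Z i = (\<chi> f g. if f = g then omega TYPE('m) ^ nat (to_int_mod_ring (g i)) else 0)"

definition pauli_Y :: "'n::finite \<Rightarrow> ('n, 'm::nontriv) op" where
  "pauli_Y i = mat \<i> ** pauli_X i ** pauli_Z i"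

text \<open>
  The flag \<open>withY\<close> selects one of the two usual conventions for qubits, namely whether \<open>Y\<close> is among
  the generators. It has no effect if \<open>m \<noteq> 2\<close>.
\<close>

definition pauli_group :: "bool \<Rightarrow> ('n::finite, 'm::nontriv) op set" where
  "pauli_group withY = generate unitary_group
     (range pauli_X \<union> range pauli_Z \<union> (if withY \<and> CARD('m) = 2 then range pauli_Y else {}))"

definition up_to_phase :: "(complex ^ 'a ^ 'a) set \<Rightarrow> (complex ^ 'a ^ 'a) set" where
  "up_to_phase A = {mat c ** U | c U. cmod c = 1 \<and> U \<in> A}"

text \<open>
  The hierarchy starts at level 1; level 0 is a dummy. Commutators do not depend on the phases of
  their arguments, so closing level 1 under global phases makes every level closed under them.
\<close>

fun clifford :: "(complex ^ 'a ^ 'a) set \<Rightarrow> nat \<Rightarrow> (complex ^ 'a ^ 'a) set" where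
  "clifford P 0 = {}"
| "clifford P (Suc 0) = up_to_phase P"
| "clifford P (Suc (Suc M)) = {U. unitary U \<and> (\<forall>p\<in>P. gcomm U p \<in> clifford P (Suc M))}"


section \<open>Stabilizer codes\<close>

definition code_space :: "('n::finite, 'm::nontriv) op set \<Rightarrow> ('n, 'm) state set" where
  "code_space S = {v. \<forall>s\<in>S. s *v v = v}"

text \<open>
  The condition on the dimension excludes groups \<open>S\<close> that contain a scalar other than 1; their
  common eigenspace is zero.
\<close>

definition stabilizer_code :: "bool \<Rightarrow> nat \<Rightarrow> ('n::finite, 'm::nontriv) op set \<Rightarrow> bool" where
  "stabilizer_code withY k S \<longleftrightarrow>
     1 \<le> k \<and> k \<le> CARD('n) \<and>
     (\<exists>s :: nat \<Rightarrow> ('n, 'm) op.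
        (\<forall>i < CARD('n) - k. s i \<in> pauli_group withY) \<and>
        S = generate unitary_group (s ` {..< CARD('n) - k})) \<and>
     (\<forall>s\<in>S. \<forall>t\<in>S. s ** t = t ** s) \<and>
     card S = CARD('m) ^ (CARD('n) - k) \<and>
     vec.dim (code_space S) = CARD('m) ^ k"

definition logical_operator :: "('n::finite, 'm::nontriv) op set \<Rightarrow> ('n, 'm) op \<Rightarrow> bool" where
  "logical_operator S U \<longleftrightarrow> unitary U \<and> (\<forall>v\<in>code_space S. U *v v \<in> code_space S)"

definition logical_pauli_generators ::
  "bool \<Rightarrow> ('n::finite, 'm::nontriv) op set \<Rightarrow> ('k::finite \<Rightarrow> ('n, 'm) op) \<Rightarrow> ('k \<Rightarrow> ('n, 'm) op) \<Rightarrow> bool"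
where
  "logical_pauli_generators withY S Xbar Zbar \<longleftrightarrow>
     (\<forall>i. Xbar i \<in> pauli_group withY \<and> Zbar i \<in> pauli_group withY) \<and>
     (\<forall>i. \<forall>s\<in>S. Xbar i ** s = s ** Xbar i \<and> Zbar i ** s = s ** Zbar i) \<and>
     (\<forall>i j. gcomm (Xbar i) (Zbar j) = (if i = j then mat (inverse (omega TYPE('m))) else mat 1)) \<and>
     (\<forall>i j. gcomm (Xbar i) (Xbar j) = mat 1 \<and> gcomm (Zbar i) (Zbar j) = mat 1)"

definition logical_pauli ::
  "('k::finite \<Rightarrow> ('n::finite, 'm::nontriv) op) \<Rightarrow> ('k \<Rightarrow> ('n, 'm) op) \<Rightarrow> ('k \<Rightarrow> nat) \<Rightarrow> ('k \<Rightarrow> nat) \<Rightarrow> ('n, 'm) op"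
where
  "logical_pauli Xbar Zbar a b =
     comm_prod (\<lambda>i. (Xbar i [^]\<^bsub>unitary_group\<^esub> a i) ** (Zbar i [^]\<^bsub>unitary_group\<^esub> b i)) UNIV"

definition nontrivial_logical_paulis ::
  "('n::finite, 'm::nontriv) op set \<Rightarrow> ('k::finite \<Rightarrow> ('n, 'm) op) \<Rightarrow> ('k \<Rightarrow> ('n, 'm) op) \<Rightarrow> ('n, 'm) op set set"
where
  "nontrivial_logical_paulis S Xbar Zbar =
     {(\<lambda>s. s ** logical_pauli Xbar Zbar a b) ` S | a b.
        (\<forall>i. a i < CARD('m) \<and> b i < CARD('m)) \<and> \<not> (\<forall>i. a i = 0 \<and> b i = 0)}"

text \<open>
  An isometry \<open>V\<close> from the space of \<open>k\<close> qudits onto the code space that identifies the Pauli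
  operators of qudit \<open>i\<close> with \<open>Xbar i\<close> and \<open>Zbar i\<close>. Phases have to be allowed here: the relations
  on \<open>Xbar i\<close> and \<open>Zbar i\<close> do not force their \<open>m\<close>-th powers to be 1 (e.g. \<open>XZ\<close> for qubits squares
  to \<open>-1\<close>).
\<close>

definition logical_identification ::
  "('n::finite, 'm::nontriv) op set \<Rightarrow> ('k::finite \<Rightarrow> ('n, 'm) op) \<Rightarrow> ('k \<Rightarrow> ('n, 'm) op) \<Rightarrow>
     (('k, 'm) state, 'n \<Rightarrow> 'm mod_ring) vec \<Rightarrow> bool"
where
  "logical_identification S Xbar Zbar V \<longleftrightarrow>
     dagger V ** V = mat 1 \<and>
     range ((*v) V) = code_space S \<and>
     (\<forall>i. \<exists>c. cmod c = 1 \<and> Xbar i ** V = mat c ** V ** pauli_X i) \<and>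
     (\<forall>i. \<exists>c. cmod c = 1 \<and> Zbar i ** V = mat c ** V ** pauli_Z i)"

text \<open>
  Identifications differ only by global phases and Pauli operators on the \<open>k\<close> qudits, so the
  choice of \<open>V\<close> is immaterial. Both existence and independence of the choice are made part of the
  definition.
\<close>

definition logical_clifford ::
  "bool \<Rightarrow> ('n::finite, 'm::nontriv) op set \<Rightarrow> ('k::finite \<Rightarrow> ('n, 'm) op) \<Rightarrow> ('k \<Rightarrow> ('n, 'm) op) \<Rightarrow>
     nat \<Rightarrow> ('n, 'm) op set"
where
  "logical_clifford withY S Xbar Zbar M =
     {U. logical_operator S U \<and>
         (\<exists>V. logical_identification S Xbar Zbar V) \<and>
         (\<forall>V. logical_identification S Xbar Zbar V \<longrightarrow>
            dagger V ** U ** V \<in> clifford (pauli_group withY) M)}"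


section \<open>Locality, distances and disjointness with respect to a partition\<close>

text \<open>The partition \<open>Q\<close> is the set of its blocks, and supports are sets of blocks.\<close>

definition supp :: "'n::finite set set \<Rightarrow> ('n, 'm::nontriv) op \<Rightarrow> 'n set set" where
  "supp Q U = {B \<in> Q. \<not> acts_only_on (- B) U}"

text \<open>
  A tensor product of unitaries \<open>u R\<close> on the blocks \<open>R\<close> is the product of the commuting operators
  \<open>W R = u R \<otimes> 1\<close>.
\<close>

definition transversal :: "'n::finite set set \<Rightarrow> ('n, 'm::nontriv) op \<Rightarrow> bool" where
  "transversal P U \<longleftrightarrow>
     (\<exists>W. (\<forall>R\<in>P. unitary (W R) \<and> acts_only_on R (W R)) \<and> U = comm_prod W P)"

definition local_depth_one :: "'n::finite set set \<Rightarrow> nat \<Rightarrow> ('n, 'm::nontriv) op \<Rightarrow> bool" where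
  "local_depth_one Q q U \<longleftrightarrow>
     (\<exists>P. partition_on UNIV P \<and> (\<forall>R\<in>P. \<exists>B. B \<subseteq> Q \<and> card B \<le> q \<and> R = \<Union>B) \<and> transversal P U)"

definition local_circuit :: "'n::finite set set \<Rightarrow> nat \<Rightarrow> nat \<Rightarrow> ('n, 'm::nontriv) op \<Rightarrow> bool" where
  "local_circuit Q q h U \<longleftrightarrow>
     (\<exists>Us. length Us = h \<and> (\<forall>T\<in>set Us. local_depth_one Q q T) \<and> U = foldr (**) Us (mat 1))"

definition dist_coset :: "'n::finite set set \<Rightarrow> ('n, 'm::nontriv) op set \<Rightarrow> nat" where
  "dist_coset Q G = Min ((\<lambda>g. card (supp Q g)) ` G)"

definition min_distance :: "'n::finite set set \<Rightarrow> ('n, 'm::nontriv) op set set \<Rightarrow> nat" where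
  "min_distance Q L = Min (dist_coset Q ` L)"

definition max_distance :: "'n::finite set set \<Rightarrow> ('n, 'm::nontriv) op set set \<Rightarrow> nat" where
  "max_distance Q L = Max (dist_coset Q ` L)"

definition c_disjoint :: "'n::finite set set \<Rightarrow> nat \<Rightarrow> ('n, 'm::nontriv) op set \<Rightarrow> bool" where
  "c_disjoint Q c A \<longleftrightarrow> (\<forall>B\<in>Q. card {a \<in> A. B \<in> supp Q a} \<le> c)"

definition c_disjointness :: "'n::finite set set \<Rightarrow> nat \<Rightarrow> ('n, 'm::nontriv) op set \<Rightarrow> real" where
  "c_disjointness Q c G = real (Max (card ` {A. A \<subseteq> G \<and> c_disjoint Q c A})) / real c"

text \<open>
  The supremum is a maximum: for \<open>c\<close> at least the common cardinality of the cosets in \<open>L\<close>, the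
  \<open>c\<close>-disjointness of each of them is that cardinality divided by \<open>c\<close>, which decreases in \<open>c\<close>.
\<close>

definition disjointness :: "'n::finite set set \<Rightarrow> ('n, 'm::nontriv) op set set \<Rightarrow> real" where
  "disjointness Q L = (SUP c\<in>{1..}. Min (c_disjointness Q c ` L))"

end

theory Submission
  imports Defs "HOL-Library.Function_Algebras"
begin

text \<open>
  The proof follows \<open>U\<close> through iterated commutators with logical Paulis. If \<open>U\<close> is a circuit of
  depth \<open>h\<close> and \<open>p\<close> is a Pauli, then \<open>[U, p]\<close> is a circuit of depth \<open>2 h\<close>, supported in the light
  cone of \<open>supp U \<inter> supp p\<close>: the part of \<open>p\<close> off \<open>supp U\<close> commutes with \<open>U\<close>. The cone has at most
  \<open>q\<^sup>h\<close> times as many blocks. Every nontrivial logical class has a representative \<open>p\<close> for which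
  \<open>\<bar>supp U \<inter> supp p\<bar> \<le> \<bar>supp U\<bar> / \<Delta>\<close>, and in the first step one with \<open>\<bar>supp p\<bar> \<le> d\<^sub>\<up>\<close>. So after \<open>M\<close>
  commutators fewer than \<open>d\<^sub>\<down>\<close> blocks are left. An operator supported on so few blocks
  encodes a scalar, because its traces against all elements of nontrivial logical classes vanish.

  Supports are handled through the fact that an operator acts only on \<open>A\<close> iff it commutes with
  \<open>X i\<close> and \<open>Z i\<close> for all \<open>i\<close> outside \<open>A\<close>.
\<close>

section \<open>Complex matrices\<close>

text \<open>Physical and logical commutators are tied together by the relation
  \<open>U ** V = V ** W\<close>, where \<open>V\<close> is an isometry onto the code space. It
  passes to daggers and products, hence to commutators, so the encoded \<open>W\<close> never has to
  be computed; and since all members of a logical coset encode the same Weyl operator up to a phase,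
  a representative may be chosen purely for its support. The constant \<open>2 ^ M - 1\<close> comes
  from the depths: the \<open>M\<close> commutators are taken of circuits of depths
  \<open>h\<close>, \<open>2 * h\<close>, ..., \<open>2 ^ (M - 1) * h\<close>, and the light cone
  exponents add up to \<open>(2 ^ M - 1) * h\<close>. The chain ends one level below the Paulis, at
  a phase. A level 0 is therefore added to the hierarchy, and a unitary whose commutators with all
  Paulis are phases has to be recognised as a Pauli. A second obstacle is that logical Clifford
  operators presuppose an identification of the code space. Phases hinder its construction, because
  the \<open>m\<close>-th power of a logical Pauli need not be 1; the generators are rescaled first,
  and a basis is then obtained by shifting a common fixed vector.\<close>

definition cscale :: "complex \<Rightarrow> complex ^ 'a ^ 'b \<Rightarrow> complex ^ 'a ^ 'b" where
  "cscale c A = (\<chi> i j. c * A $ i $ j)"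

lemma cscale_nth [simp]: "cscale c A $ i $ j = c * A $ i $ j"
  by (simp add: cscale_def)

lemma dagger_nth [simp]: "dagger A $ i $ j = cnj (A $ j $ i)"
  by (simp add: dagger_def)

lemma mat_mult_nth: "(A ** B) $ i $ j = (\<Sum>k\<in>UNIV. A $ i $ k * B $ k $ j)"
  by (simp add: matrix_matrix_mult_def)

lemma matrix_eqI: "(\<And>i j. A $ i $ j = B $ i $ j) \<Longrightarrow> A = B"
  by (simp add: vec_eq_iff)

lemma cscale_mult_left [simp]: "cscale c A ** B = cscale c (A ** B)"
  by (rule matrix_eqI) (simp add: mat_mult_nth sum_distrib_left mult.assoc)

lemma cscale_mult_right [simp]: "A ** cscale c B = cscale c (A ** B)"
  by (rule matrix_eqI) (simp add: mat_mult_nth sum_distrib_left algebra_simps)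

lemma cscale_cscale [simp]: "cscale c (cscale d A) = cscale (c * d) A"
  by (rule matrix_eqI) simp

lemma cscale_one [simp]: "cscale 1 A = A"
  by (rule matrix_eqI) simp

lemma cscale_vec [simp]: "cscale c A *v v = c *s (A *v v)"
  by (simp add: vec_eq_iff matrix_vector_mult_def sum_distrib_left mult.assoc)

lemma mat_eq_cscale: "mat c = cscale c (mat 1)"
  by (rule matrix_eqI) (simp add: mat_def)

lemma mat_mult_eq_cscale [simp]: "mat c ** A = cscale c A"
  by (subst mat_eq_cscale) simp

lemma dagger_mult: "dagger (A ** B) = dagger B ** dagger A"
  by (rule matrix_eqI) (simp add: mat_mult_nth mult.commute)

lemma dagger_dagger [simp]: "dagger (dagger A) = A"
  by (rule matrix_eqI) simp

lemma dagger_cscale [simp]: "dagger (cscale c A) = cscale (cnj c) (dagger A)"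
  by (rule matrix_eqI) simp

lemma dagger_mat_1 [simp]: "dagger (mat 1) = mat 1"
  by (rule matrix_eqI) (simp add: mat_def)

lemma cmod_1_cnj [simp]: "cmod c = 1 \<Longrightarrow> cnj c * c = 1" "cmod c = 1 \<Longrightarrow> c * cnj c = 1"
  using complex_norm_square [of c] by (simp_all add: mult.commute)

lemma unitaryD [simp]: "unitary U \<Longrightarrow> dagger U ** U = mat 1" "unitary U \<Longrightarrow> U ** dagger U = mat 1"
  by (simp_all add: unitary_def)

lemma unitaryD_assoc [simp]:
  "unitary U \<Longrightarrow> dagger U ** (U ** A) = A" "unitary U \<Longrightarrow> U ** (dagger U ** A) = A"
  by (simp_all add: matrix_mul_assoc)

lemma unitaryI: "dagger U ** U = mat 1 \<Longrightarrow> unitary U"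
  using matrix_left_right_inverse unitary_def by blast

lemma unitary_mat_1 [simp]: "unitary (mat 1)"
  by (rule unitaryI) simp

lemma unitary_mult [simp]: "unitary U \<Longrightarrow> unitary W \<Longrightarrow> unitary (U ** W)"
  by (rule unitaryI) (simp add: dagger_mult flip: matrix_mul_assoc)

lemma unitary_dagger [simp]: "unitary U \<Longrightarrow> unitary (dagger U)"
  unfolding unitary_def by (simp only: dagger_dagger)

lemma unitary_cscale [simp]: "unitary U \<Longrightarrow> cmod c = 1 \<Longrightarrow> unitary (cscale c U)"
  by (rule unitaryI) simp

lemma unitary_gcomm [simp]: "unitary U \<Longrightarrow> unitary W \<Longrightarrow> unitary (gcomm U W)"
  by (simp add: gcomm_def)

lemma unitary_group_simps [simp]:
  "carrier unitary_group = Collect unitary" "x \<otimes>\<^bsub>unitary_group\<^esub> y = x ** y" "\<one>\<^bsub>unitary_group\<^esub> = mat 1"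
  by (simp_all add: unitary_group_def)

lemma group_unitary_group: "group unitary_group"
proof (rule groupI)
  show "\<exists>y\<in>carrier unitary_group. y \<otimes>\<^bsub>unitary_group\<^esub> x = \<one>\<^bsub>unitary_group\<^esub>"
    if "x \<in> carrier unitary_group" for x :: "complex ^ 'a ^ 'a"
    using that by (intro bexI [of _ "dagger x"]) auto
qed (simp_all add: matrix_mul_assoc)

interpretation unitary_group: group unitary_group
  by (rule group_unitary_group)

lemma unitary_group_inv [simp]: "unitary U \<Longrightarrow> inv\<^bsub>unitary_group\<^esub> U = dagger U"
  by (rule unitary_group.inv_equality) auto

lemma commutation_if_gcomm_scalar:
  "unitary A \<Longrightarrow> gcomm U A = cscale c (mat 1) \<Longrightarrow> unitary U \<Longrightarrow> U ** A = cscale c (A ** U)"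
proof -
  assume A: "unitary A" and U: "unitary U" and g: "gcomm U A = cscale c (mat 1)"
  have "U ** A = gcomm U A ** A ** U"
    using A U by (simp add: gcomm_def flip: matrix_mul_assoc)
  then show ?thesis by (simp add: g)
qed

text \<open>The phase meets its own conjugate inside the commutator. This is what allows Paulis to
  be replaced by bare Weyl operators later on.\<close>

lemma gcomm_cscale:
  assumes "cmod c = 1" shows "gcomm U (cscale c A) = gcomm U A"
  using assms by (simp add: gcomm_def)

lemma gcomm_one_left [simp]: "unitary A \<Longrightarrow> gcomm (mat 1) A = mat 1"
  by (simp add: gcomm_def)

lemma gcomm_one_right [simp]: "unitary A \<Longrightarrow> gcomm A (mat 1) = mat 1"
  by (simp add: gcomm_def)

lemma gcomm_eq_1_iff: "unitary A \<Longrightarrow> unitary U \<Longrightarrow> gcomm U A = mat 1 \<longleftrightarrow> U ** A = A ** U"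
proof
  show "U ** A = A ** U" if "unitary A" "unitary U" "gcomm U A = mat 1"
    using commutation_if_gcomm_scalar[of A U 1] that by simp
  show "gcomm U A = mat 1" if "unitary A" "unitary U" "U ** A = A ** U"
    using that by (simp add: gcomm_def flip: matrix_mul_assoc)
qed

lemma commute_dagger_left:
  assumes "unitary A" "A ** B = B ** A"
  shows "dagger A ** B = B ** dagger A"
proof -
  have "dagger A ** B = dagger A ** (B ** A) ** dagger A"
    using assms(1) by (simp flip: matrix_mul_assoc)
  also have "\<dots> = B ** dagger A"
    using assms(1) unfolding assms(2) [symmetric] by (simp flip: matrix_mul_assoc)
  finally show ?thesis .
qed

lemma commute_mult:
  fixes B :: "complex ^ 'a ^ 'a"
  assumes "A ** B = B ** A" "C ** B = B ** C"
  shows "(A ** C) ** B = B ** (A ** C)"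
proof -
  have "(A ** C) ** B = A ** B ** C"
    by (simp only: assms(2) flip: matrix_mul_assoc)
  then show ?thesis
    by (simp only: assms(1) matrix_mul_assoc)
qed

lemma commute_dagger_right:
  "unitary B \<Longrightarrow> A ** B = B ** A \<Longrightarrow> A ** dagger B = dagger B ** A"
  using commute_dagger_left [of B A] by simp

lemma commute_dagger_both:
  "A ** B = B ** A \<Longrightarrow> dagger A ** dagger B = dagger B ** dagger A"
  by (simp flip: dagger_mult)

subsection \<open>Products of commuting families\<close>

lemma comm_prod_empty [simp]: "comm_prod W {} = mat 1"
  by (simp add: comm_prod_def)

lemma comm_prod_insert:
  assumes "finite I" "i \<notin> I"
    and "\<And>x y. x \<in> insert i I \<Longrightarrow> y \<in> insert i I \<Longrightarrow> x \<noteq> y \<Longrightarrow> W x ** W y = W y ** W x"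
  shows "comm_prod W (insert i I) = W i ** comm_prod W I"
proof -
  \<comment> \<open>The fold locale also asks for the diagonal case, which the hypothesis leaves
    out.\<close>
  have "W x ** W y = W y ** W x" if "x \<in> insert i I" "y \<in> insert i I" for x y
    using assms(3) that by (cases "x = y") auto
  then interpret comp_fun_commute_on "insert i I" "\<lambda>i A. W i ** A"
    by unfold_locales (simp only: fun_eq_iff o_def matrix_mul_assoc, simp)
  show ?thesis
    unfolding comm_prod_def by (rule fold_insert) (use assms in auto)
qed

lemma comm_prod_commute:
  assumes "finite I"
    and "\<And>x y. x \<in> I \<Longrightarrow> y \<in> I \<Longrightarrow> x \<noteq> y \<Longrightarrow> W x ** W y = W y ** W x"
    and "\<And>x. x \<in> I \<Longrightarrow> W x ** A = A ** W x"
  shows "comm_prod W I ** A = A ** comm_prod W I"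
  using assms
proof (induction I)
  case (insert i I)
  have "comm_prod W (insert i I) = W i ** comm_prod W I"
    by (rule comm_prod_insert) (use insert in auto)
  with insert show ?case by (simp add: commute_mult)
qed simp

lemma comm_prod_cong:
  assumes "finite I"
    and "\<And>x y. x \<in> I \<Longrightarrow> y \<in> I \<Longrightarrow> x \<noteq> y \<Longrightarrow> W x ** W y = W y ** W x"
    and "\<And>x. x \<in> I \<Longrightarrow> W x = W' x"
  shows "comm_prod W I = comm_prod W' I"
  using assms
proof (induction I)
  case (insert i I)
  have "comm_prod W (insert i I) = W i ** comm_prod W I"
       "comm_prod W' (insert i I) = W' i ** comm_prod W' I"
    by (rule comm_prod_insert; use insert in auto)+
  with insert show ?case by simp
qed simp

lemma comm_prod_unitary:
  assumes "finite I"
    and "\<And>x y. x \<in> I \<Longrightarrow> y \<in> I \<Longrightarrow> x \<noteq> y \<Longrightarrow> W x ** W y = W y ** W x"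
    and "\<And>x. x \<in> I \<Longrightarrow> unitary (W x)"
  shows "unitary (comm_prod W I)"
  using assms
proof (induction I)
  case (insert i I)
  have "comm_prod W (insert i I) = W i ** comm_prod W I"
    by (rule comm_prod_insert) (use insert in auto)
  with insert show ?case by simp
qed simp

lemma comm_prod_dagger:
  assumes "finite I"
    and "\<And>x y. x \<in> I \<Longrightarrow> y \<in> I \<Longrightarrow> x \<noteq> y \<Longrightarrow> W x ** W y = W y ** W x"
  shows "dagger (comm_prod W I) = comm_prod (\<lambda>i. dagger (W i)) I"
  using assms
proof (induction I)
  case (insert i I)
  have comm: "dagger (W x) ** dagger (W y) = dagger (W y) ** dagger (W x)"
    if "x \<in> insert i I" "y \<in> insert i I" "x \<noteq> y" for x y
    using insert.prems that by (intro commute_dagger_both) auto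
  have 1: "comm_prod W (insert i I) = W i ** comm_prod W I"
    by (rule comm_prod_insert) (use insert in auto)
  have 2: "comm_prod (\<lambda>i. dagger (W i)) (insert i I) = dagger (W i) ** comm_prod (\<lambda>i. dagger (W i)) I"
    by (rule comm_prod_insert) (use insert comm in auto)
  have "W i ** comm_prod W I = comm_prod W I ** W i"
    by (rule comm_prod_commute [symmetric]) (use insert in auto)
  with insert show ?case by (simp add: 1 2 dagger_mult)
qed simp

lemma comm_prod_conj:
  assumes "finite I" "unitary p"
    and "\<And>x y. x \<in> I \<Longrightarrow> y \<in> I \<Longrightarrow> x \<noteq> y \<Longrightarrow> W x ** W y = W y ** W x"
  shows "p ** comm_prod W I ** dagger p = comm_prod (\<lambda>i. p ** W i ** dagger p) I"
  using assms
proof (induction I)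
  case (insert i I)
  have comm: "(p ** W x ** dagger p) ** (p ** W y ** dagger p)
      = (p ** W y ** dagger p) ** (p ** W x ** dagger p)"
    if "x \<in> insert i I" "y \<in> insert i I" "x \<noteq> y" for x y
  proof -
    have "(p ** W x ** dagger p) ** (p ** W y ** dagger p) = p ** (W x ** W y) ** dagger p" for x y
      using \<open>unitary p\<close> by (simp flip: matrix_mul_assoc)
    then show ?thesis using insert.prems(2) [of x y] that by simp
  qed
  have 1: "comm_prod W (insert i I) = W i ** comm_prod W I"
    by (rule comm_prod_insert) (use insert in auto)
  have 2: "comm_prod (\<lambda>i. p ** W i ** dagger p) (insert i I)
      = (p ** W i ** dagger p) ** comm_prod (\<lambda>i. p ** W i ** dagger p) I"
    by (rule comm_prod_insert) (use insert comm in auto)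
  have "comm_prod (\<lambda>i. p ** W i ** dagger p) I = p ** comm_prod W I ** dagger p"
    using insert by auto
  then show ?case
    unfolding 1 2 using \<open>unitary p\<close> by (simp flip: matrix_mul_assoc)
qed simp

section \<open>Weyl operators\<close>

definition chi :: "'m::nontriv mod_ring \<Rightarrow> complex" where
  "chi x = omega TYPE('m) ^ nat (to_int_mod_ring x)"

lemma omega_power: "omega TYPE('m::nontriv) ^ n = cis (2 * pi * real n / real CARD('m))"
  by (simp add: omega_def Complex.DeMoivre mult_ac)

lemma omega_power_card [simp]: "omega TYPE('m::nontriv) ^ CARD('m) = 1"
  by (simp add: omega_power)

lemma omega_power_mod: "omega TYPE('m::nontriv) ^ (n mod CARD('m)) = omega TYPE('m) ^ n"
proof -
  have "omega TYPE('m) ^ n = omega TYPE('m) ^ (CARD('m) * (n div CARD('m)) + n mod CARD('m))"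
    by simp
  also have "\<dots> = omega TYPE('m) ^ (n mod CARD('m))"
    by (simp only: power_add power_mult omega_power_card power_one mult_1)
  finally show ?thesis by simp
qed

lemma to_int_mod_ring_of_nat: "to_int_mod_ring (of_nat n :: 'm::nontriv mod_ring) = int (n mod CARD('m))"
  by (transfer) (simp add: zmod_int)

lemma to_int_mod_ring_bounds: "0 \<le> to_int_mod_ring (x :: 'm::nontriv mod_ring)" "to_int_mod_ring x < int CARD('m)"
  using range_to_int_mod_ring [where 'a = 'm] by (metis atLeastLessThan_iff rangeI)+

lemma of_nat_nat_to_int [simp]: "of_nat (nat (to_int_mod_ring (x :: 'm::nontriv mod_ring))) = x"
  by (metis nat_0_le of_int_mod_ring_to_int_mod_ring of_int_of_int_mod_ring of_int_of_nat_eq to_int_mod_ring_bounds(1))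

lemma mod_ring_of_nat_cases:
  obtains n where "n < CARD('m)" "(x :: 'm::nontriv mod_ring) = of_nat n"
  using to_int_mod_ring_bounds [of x] of_nat_nat_to_int [of x] by (metis nat_less_iff)

lemma chi_of_nat: "chi (of_nat n :: 'm::nontriv mod_ring) = omega TYPE('m) ^ n"
  by (simp add: chi_def to_int_mod_ring_of_nat omega_power_mod)

lemma chi_0 [simp]: "chi 0 = 1"
  using chi_of_nat [of 0] by simp

lemma chi_1 [simp]: "chi (1 :: 'm::nontriv mod_ring) = omega TYPE('m)"
  using chi_of_nat [of 1] by simp

lemma chi_add: "chi (x + y) = chi x * chi (y :: 'm::nontriv mod_ring)"
proof -
  obtain n k where "x = of_nat n" "y = of_nat k"
    by (metis of_nat_nat_to_int)
  then show ?thesis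
    by (simp add: chi_of_nat power_add flip: of_nat_add)
qed

text \<open>The character is faithful because the \<open>m\<close>-th roots of unity are listed
  without repetition. The vanishing of character sums and the reading of exponents off commutation
  phases both rest on this.\<close>

lemma chi_eq_1_iff [simp]: "chi x = 1 \<longleftrightarrow> (x :: 'm::nontriv mod_ring) = 0"
proof
  assume 1: "chi x = 1"
  obtain n where n: "n < CARD('m)" "x = of_nat n"
    by (rule mod_ring_of_nat_cases)
  have "inj_on (\<lambda>k. cis (2 * pi * real k / real CARD('m))) {..<CARD('m)}"
    using Complex.bij_betw_roots_unity [of "CARD('m)"] by (simp add: bij_betw_def)
  from inj_onD [OF this, of n 0] have "n = 0"
    using 1 n by (simp add: chi_of_nat omega_power)
  then show "x = 0"
    using n by simp
qed simp

lemma cmod_chi [simp]: "cmod (chi x) = 1"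
  by (simp add: chi_def omega_power)

lemma chi_nonzero [simp]: "chi x \<noteq> 0"
  using cmod_chi [of x] by force

lemma chi_minus: "chi (- x) = inverse (chi (x :: 'm::nontriv mod_ring))"
  using chi_add [of x "- x"] by (simp add: inverse_unique)

lemma cnj_chi [simp]: "cnj (chi x) = chi (- (x :: 'm::nontriv mod_ring))"
  using cmod_1_cnj(2) [OF cmod_chi [of x]] by (metis chi_minus inverse_unique)

lemma root_of_unity_eq_chi:
  assumes "z ^ CARD('m) = 1"
  obtains x where "z = chi (x :: 'm::nontriv mod_ring)"
proof -
  have "z \<in> (\<lambda>k. cis (2 * pi * real k / real CARD('m))) ` {..<CARD('m)}"
    using Complex.bij_betw_roots_unity [of "CARD('m)"] assms by (auto simp: bij_betw_def)
  then obtain k where "z = chi (of_nat k :: 'm mod_ring)"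
    by (auto simp: chi_of_nat omega_power)
  then show ?thesis by (rule that)
qed

definition dot :: "('n::finite \<Rightarrow> 'm::nontriv mod_ring) \<Rightarrow> ('n \<Rightarrow> 'm mod_ring) \<Rightarrow> 'm mod_ring" where
  "dot b g = (\<Sum>i\<in>UNIV. b i * g i)"

lemma dot_simps [simp]:
  "dot (a + b) g = dot a g + dot b g" "dot a (g + h) = dot a g + dot a h"
  "dot a (- g) = - dot a g" "dot (- a) g = - dot a g" "dot 0 g = 0" "dot a 0 = 0"
  "dot a (g - h) = dot a g - dot a h" "dot (a - b) g = dot a g - dot b g"
  by (simp_all add: dot_def sum.distrib sum_negf sum_subtractf algebra_simps)

definition unit_fun :: "'n \<Rightarrow> 'm::nontriv mod_ring \<Rightarrow> 'n \<Rightarrow> 'm mod_ring" where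
  "unit_fun i x = (\<lambda>j. if j = i then x else 0)"

lemma dot_unit_fun [simp]: "dot (unit_fun i x) g = x * g i" "dot g (unit_fun i x) = g i * x"
proof -
  have "(if j = i then x else 0) * g j = (if j = i then x * g j else 0)"
       "g j * (if j = i then x else 0) = (if j = i then g j * x else 0)" for j
    by auto
  then show "dot (unit_fun i x) g = x * g i" "dot g (unit_fun i x) = g i * x"
    by (simp_all add: dot_def unit_fun_def)
qed

lemma unit_fun_add: "unit_fun i (x + y) = unit_fun i x + unit_fun i y"
  by (auto simp: unit_fun_def fun_eq_iff)

lemma unit_fun_0 [simp]: "unit_fun i 0 = 0"
  by (auto simp: unit_fun_def fun_eq_iff)

lemma fun_upd_eq_unit_fun: "g(i := g i + x) = g + unit_fun i x"
  by (auto simp: unit_fun_def fun_eq_iff)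

text \<open>Since 1 generates the integers modulo \<open>m\<close> additively, unit vectors at
  places in \<open>A\<close> reach every vector supported on \<open>A\<close>. This carries facts
  about single generators \<open>pauli_X i\<close> and \<open>pauli_Z i\<close> over to arbitrary
  shifts.\<close>

lemma unit_fun_induct:
  fixes t :: "'n::finite \<Rightarrow> 'm::nontriv mod_ring"
  assumes supp: "\<And>i. i \<notin> A \<Longrightarrow> t i = 0"
    and zero: "P 0"
    and add: "\<And>i t. i \<in> A \<Longrightarrow> P t \<Longrightarrow> P (t + unit_fun i 1)"
  shows "P t"
proof -
  have unit: "P (s + unit_fun i (of_nat n))" if "i \<in> A" "P s" for i s n
  proof (induction n)
    case (Suc n)
    have "s + unit_fun i (of_nat (Suc n)) = (s + unit_fun i (of_nat n)) + unit_fun i 1"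
      by (simp add: unit_fun_add add_ac)
    with add [OF \<open>i \<in> A\<close> Suc] show ?case by (simp only:)
  qed (use that in simp)
  have "P (\<lambda>j. if j \<in> F then t j else 0)" if "finite F" "F \<subseteq> A" for F
    using that
  proof (induction F)
    case (insert i F)
    \<comment> \<open>The coordinate \<open>t i\<close> is written as a natural number, so that it
      can be reached by repeated addition of 1.\<close>
    have eq: "(\<lambda>j. if j \<in> insert i F then t j else 0)
        = (\<lambda>j. if j \<in> F then t j else 0) + unit_fun i (of_nat (nat (to_int_mod_ring (t i))))"
      using insert by (auto simp: fun_eq_iff unit_fun_def)
    show ?case
      unfolding eq by (rule unit) (use insert in auto)
  qed (use zero in \<open>simp add: zero_fun_def\<close>)
  from this [of A] have "P (\<lambda>j. if j \<in> A then t j else 0)"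
    by simp
  also have "(\<lambda>j. if j \<in> A then t j else 0) = t"
    using supp by auto
  finally show ?thesis .
qed

text \<open>The monomial with \<open>X\<close>-exponents \<open>a\<close> and
  \<open>Z\<close>-exponents \<open>b\<close>, the \<open>Z\<close> part acting first: the basis
  vector \<open>g\<close> goes to \<open>g + a\<close> with factor
  \<open>chi (dot b g)\<close>.\<close>

definition weyl :: "('n::finite \<Rightarrow> 'm::nontriv mod_ring) \<Rightarrow> ('n \<Rightarrow> 'm mod_ring) \<Rightarrow> ('n, 'm) op" where
  "weyl a b = (\<chi> f g. if f = g + a then chi (dot b g) else 0)"

lemma weyl_nth: "weyl a b $ f $ g = (if f = g + a then chi (dot b g) else 0)"
  by (simp add: weyl_def)

lemma mult_weyl_nth: "(U ** weyl a b) $ f $ g = U $ f $ (g + a) * chi (dot b g)"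
proof -
  have "(U ** weyl a b) $ f $ g = (\<Sum>h\<in>UNIV. if h = g + a then U $ f $ h * chi (dot b g) else 0)"
    unfolding mat_mult_nth by (rule sum.cong) (auto simp: weyl_nth)
  then show ?thesis by simp
qed

lemma weyl_mult_nth: "(weyl a b ** U) $ f $ g = chi (dot b (f - a)) * U $ (f - a) $ g"
proof -
  have "(weyl a b ** U) $ f $ g = (\<Sum>h\<in>UNIV. if h = f - a then chi (dot b h) * U $ h $ g else 0)"
    unfolding mat_mult_nth by (rule sum.cong) (auto simp: weyl_nth)
  then show ?thesis by simp
qed

lemma weyl_mult: "weyl a b ** weyl a' b' = cscale (chi (dot b a')) (weyl (a + a') (b + b'))"
proof (rule matrix_eqI)
  fix f g
  have "f = g + a' + a \<longleftrightarrow> f = g + (a + a')"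
    by (simp add: algebra_simps)
  then show "(weyl a b ** weyl a' b') $ f $ g = cscale (chi (dot b a')) (weyl (a + a') (b + b')) $ f $ g"
    by (auto simp: mult_weyl_nth weyl_nth chi_add)
qed

lemma weyl_0 [simp]: "weyl 0 0 = mat 1"
  by (rule matrix_eqI) (simp add: weyl_nth mat_def)

lemma dagger_weyl: "dagger (weyl a b) = cscale (chi (dot b a)) (weyl (- a) (- b))"
proof (rule matrix_eqI)
  fix f g
  have "g = f + a \<longleftrightarrow> f = g - a"
    by (auto simp: algebra_simps)
  then show "dagger (weyl a b) $ f $ g = cscale (chi (dot b a)) (weyl (- a) (- b)) $ f $ g"
    by (auto simp: weyl_nth simp flip: chi_add)
qed

lemma unitary_weyl [simp]: "unitary (weyl a b)"
  by (rule unitaryI) (simp add: dagger_weyl weyl_mult flip: chi_add)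

lemma pauli_X_eq_weyl: "pauli_X i = weyl (unit_fun i 1) 0"
  by (rule matrix_eqI) (simp add: pauli_X_def weyl_nth fun_upd_eq_unit_fun)

lemma pauli_Z_eq_weyl: "pauli_Z i = weyl 0 (unit_fun i 1)"
  by (rule matrix_eqI) (simp add: pauli_Z_def weyl_nth chi_def)

lemma unitary_pauli_XZ [simp]: "unitary (pauli_X i)" "unitary (pauli_Z i)"
  by (simp_all add: pauli_X_eq_weyl pauli_Z_eq_weyl)

text \<open>The exponent of the phase is the symplectic form of the two exponent pairs.\<close>

lemma weyl_commutation:
  "weyl a b ** weyl a' b' = cscale (chi (dot b a' - dot b' a)) (weyl a' b' ** weyl a b)"
proof -
  have "chi (dot b a') = chi (dot b a' - dot b' a) * chi (dot b' a)"
    by (simp flip: chi_add)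
  then show ?thesis by (simp add: weyl_mult add.commute)
qed

text \<open>Allowing every phase makes the predicate independent of the convention for
  \<open>Y\<close> and closed under products, daggers and rescaling.\<close>

definition is_pauli :: "('n::finite, 'm::nontriv) op \<Rightarrow> bool" where
  "is_pauli p \<longleftrightarrow> (\<exists>c a b. cmod c = 1 \<and> p = cscale c (weyl a b))"

lemma is_pauliE:
  assumes "is_pauli p"
  obtains c a b where "cmod c = 1" "p = cscale c (weyl a b)"
  using assms by (auto simp: is_pauli_def)

lemma is_pauli_weyl [simp]: "is_pauli (weyl a b)"
  unfolding is_pauli_def by (rule exI [of _ 1]) auto

lemma is_pauli_cscale [simp]: "is_pauli p \<Longrightarrow> cmod c = 1 \<Longrightarrow> is_pauli (cscale c p)"
  unfolding is_pauli_def by (metis cscale_cscale norm_mult mult_1)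

lemma is_pauli_mult [simp]: "is_pauli p \<Longrightarrow> is_pauli p' \<Longrightarrow> is_pauli (p ** p')"
  by (auto elim!: is_pauliE simp: weyl_mult norm_mult intro!: is_pauli_cscale)

lemma is_pauli_dagger [simp]: "is_pauli p \<Longrightarrow> is_pauli (dagger p)"
  by (auto elim!: is_pauliE simp: dagger_weyl norm_mult intro!: is_pauli_cscale)

lemma is_pauli_unitary [simp]: "is_pauli p \<Longrightarrow> unitary p"
  by (auto elim!: is_pauliE)

lemma is_pauli_XZ [simp]: "is_pauli (pauli_X i)" "is_pauli (pauli_Z i)"
  by (simp_all add: pauli_X_eq_weyl pauli_Z_eq_weyl)

lemma is_pauli_mat_1 [simp]: "is_pauli (mat 1)"
  using is_pauli_weyl [of 0 0] by simp

lemma is_pauli_pow [simp]: "is_pauli p \<Longrightarrow> is_pauli (p [^]\<^bsub>unitary_group\<^esub> (n::nat))"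
  by (induction n) auto

lemma is_pauli_commutation:
  assumes "is_pauli p" "is_pauli p'"
  obtains c where "cmod c = 1" "p ** p' = cscale c (p' ** p)"
proof -
  from assms obtain c a b c' a' b' where "cmod c = 1" "p = cscale c (weyl a b)"
    "cmod c' = 1" "p' = cscale c' (weyl a' b')"
    by (metis is_pauliE)
  then show ?thesis
    using weyl_commutation [of a b a' b'] that [of "chi (dot b a' - dot b' a)"]
    by (simp add: mult_ac)
qed

lemma is_pauli_comm_prod:
  assumes "finite I"
    and "\<And>x y. x \<in> I \<Longrightarrow> y \<in> I \<Longrightarrow> x \<noteq> y \<Longrightarrow> W x ** W y = W y ** W x"
    and "\<And>x. x \<in> I \<Longrightarrow> is_pauli (W x)"
  shows "is_pauli (comm_prod W I)"
  using assms
proof (induction I)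
  case (insert i I)
  have "comm_prod W (insert i I) = W i ** comm_prod W I"
    by (rule comm_prod_insert) (use insert in auto)
  with insert show ?case by simp
qed simp

lemma generate_is_pauli:
  assumes "p \<in> generate unitary_group A" "\<And>x. x \<in> A \<Longrightarrow> is_pauli x"
  shows "is_pauli p"
  using assms by (induction rule: generate.induct) auto

lemma pauli_group_is_pauli: "p \<in> pauli_group withY \<Longrightarrow> is_pauli p"
  unfolding pauli_group_def
  by (erule generate_is_pauli)
    (auto split: if_splits simp: pauli_Y_def intro!: is_pauli_mult is_pauli_cscale)

text \<open>Partial converse of \<open>pauli_group_is_pauli\<close>: the bare Weyl operators arise
  from \<open>X\<close> and \<open>Z\<close> alone, hence under either convention for
  \<open>Y\<close>.\<close>

lemma weyl_in_pauli_group: "weyl a b \<in> pauli_group withY"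
proof -
  let ?G = "pauli_group withY :: ('a, 'b) op set"
  have one: "mat 1 \<in> ?G" and mult: "x ** y \<in> ?G" if "x \<in> ?G" "y \<in> ?G" for x y
    using that generate.one [of unitary_group] generate.eng [of _ unitary_group]
    unfolding pauli_group_def by auto
  have X: "pauli_X i \<in> ?G" and Z: "pauli_Z i \<in> ?G" for i
    unfolding pauli_group_def by (auto intro!: generate.incl)
  have "weyl a 0 \<in> ?G"
  proof (rule unit_fun_induct [of UNIV a "\<lambda>a. weyl a 0 \<in> ?G"])
    show "weyl (t + unit_fun i 1) 0 \<in> ?G" if "weyl t 0 \<in> ?G" for i t
      using mult [OF that X [of i]] by (simp add: pauli_X_eq_weyl weyl_mult)
  qed (use one [OF X X] in simp_all)
  moreover have "weyl 0 b \<in> ?G"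
  proof (rule unit_fun_induct [of UNIV b "\<lambda>b. weyl 0 b \<in> ?G"])
    show "weyl 0 (t + unit_fun i 1) \<in> ?G" if "weyl 0 t \<in> ?G" for i t
      using mult [OF that Z [of i]] by (simp add: pauli_Z_eq_weyl weyl_mult)
  qed (use one [OF X X] in simp_all)
  ultimately show ?thesis
    using mult [of "weyl a 0" "weyl 0 b"] by (simp add: weyl_mult)
qed

section \<open>Supports\<close>

lemma cscale_eq_self_iff: "unitary A \<Longrightarrow> cscale c A = A \<longleftrightarrow> c = 1"
proof
  assume "unitary A" "cscale c A = A"
  then have "cscale c (A ** dagger A) = A ** dagger A"
    by (metis cscale_mult_left)
  then have "cscale c (mat 1 :: complex ^ 'a ^ 'a) $ i $ i = mat 1 $ i $ i" for i
    using \<open>unitary A\<close> by simp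
  then show "c = 1" by (simp add: mat_def)
qed simp

lemma acts_only_on_nonzeroD:
  assumes "acts_only_on A U" "U $ f $ g \<noteq> 0" "i \<notin> A"
  shows "f i = g i"
  using assms unfolding acts_only_on_def by (metis ComplI)

lemma acts_only_on_shift:
  assumes "acts_only_on A U" "\<And>i. i \<in> A \<Longrightarrow> t i = 0"
  shows "U $ (f + t) $ (g + t) = U $ f $ g"
proof -
  have "restrict (f + t) A = restrict f A" for f
    using assms(2) by (auto simp: restrict_def)
  moreover have "(\<forall>i\<in>-A. (f + t) i = (g + t) i) \<longleftrightarrow> (\<forall>i\<in>-A. f i = g i)"
    by simp
  ultimately show ?thesis
    using assms(1) unfolding acts_only_on_def by metis
qed

text \<open>Commuting with \<open>pauli_X i\<close> makes entries invariant under a simultaneous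
  shift of row and column at \<open>i\<close>; commuting with \<open>pauli_Z i\<close> kills entries
  whose labels differ at \<open>i\<close>. Outside \<open>A\<close> the operator is therefore the
  identity factor.\<close>

lemma acts_only_onI:
  assumes X: "\<And>i. i \<notin> A \<Longrightarrow> U ** pauli_X i = pauli_X i ** U"
    and Z: "\<And>i. i \<notin> A \<Longrightarrow> U ** pauli_Z i = pauli_Z i ** U"
  shows "acts_only_on A U"
  unfolding acts_only_on_def
proof (intro exI allI)
  fix f g :: "'a \<Rightarrow> 'b mod_ring"
  have shift1: "U $ (f + unit_fun i 1) $ (g + unit_fun i 1) = U $ f $ g" if "i \<notin> A" for i f g
    using arg_cong [OF X [OF that], of "\<lambda>M. M $ (f + unit_fun i 1) $ g"]
    by (simp add: pauli_X_eq_weyl mult_weyl_nth weyl_mult_nth)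
  have shift: "\<forall>f g. U $ (f + t) $ (g + t) = U $ f $ g" if "\<And>i. i \<in> A \<Longrightarrow> t i = 0" for t
  proof (rule unit_fun_induct [of "- A"])
    fix i s
    assume i: "i \<in> - A" and s: "\<forall>f g. U $ (f + s) $ (g + s) = U $ f $ g"
    show "\<forall>f g. U $ (f + (s + unit_fun i 1)) $ (g + (s + unit_fun i 1)) = U $ f $ g"
    proof (intro allI)
      fix f g
      show "U $ (f + (s + unit_fun i 1)) $ (g + (s + unit_fun i 1)) = U $ f $ g"
        using shift1 [of i "f + s" "g + s"] i s [rule_format, of f g]
        unfolding add.assoc by simp
    qed
  qed (use that in simp_all)
  have zero: "U $ f $ g = 0" if "i \<notin> A" "f i \<noteq> g i" for i
  proof -
    have "U $ f $ g * chi (g i) = chi (f i) * U $ f $ g"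
      using arg_cong [OF Z [OF \<open>i \<notin> A\<close>], of "\<lambda>M. M $ f $ g"]
      by (simp add: pauli_Z_eq_weyl mult_weyl_nth weyl_mult_nth)
    moreover have "chi (g i) \<noteq> chi (f i)"
      using \<open>f i \<noteq> g i\<close> chi_eq_1_iff [of "f i - g i"] chi_add [of "f i" "- g i"]
      by (auto simp: chi_minus)
    ultimately show ?thesis by simp
  qed
  show "U $ f $ g = (if \<forall>i\<in>-A. f i = g i then (\<lambda>f g. U $ f $ g) (restrict f A) (restrict g A) else 0)"
  proof (cases "\<forall>i\<in>-A. f i = g i")
    case True
    \<comment> \<open>Shifting by \<open>t\<close> gives both labels the default value of
      \<open>restrict\<close> outside \<open>A\<close>, where they agree; hence the entries of
      \<open>U\<close> itself can serve as the function \<open>u\<close>.\<close>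
    define t where "t = restrict f A - f"
    have "restrict f A = f + t" "restrict g A = g + t"
      using True by (auto simp: t_def fun_eq_iff restrict_def)
    moreover have "t i = 0" if "i \<in> A" for i
      using that by (simp add: t_def)
    ultimately show ?thesis
      using shift [of t] True by simp
  qed (use zero in auto)
qed

text \<open>In each entry of either product only one intermediate label survives, a hybrid of
  \<open>f\<close> and \<open>g\<close>. Shift invariance off \<open>A\<close> and off
  \<open>B\<close> identifies the factors at the two hybrids.\<close>

lemma acts_only_on_commute_disjoint:
  fixes U W :: "('n::finite, 'm::nontriv) op"
  assumes U: "acts_only_on A U" and W: "acts_only_on B W" and "A \<inter> B = {}"
  shows "U ** W = W ** U"
proof (rule matrix_eqI)
  fix f g :: "'n \<Rightarrow> 'm mod_ring"
  define h where "h = (\<lambda>i. if i \<in> A then g i else f i)"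
  define k where "k = (\<lambda>i. if i \<in> A then f i else g i)"
  have "x = h" if "U $ f $ x * W $ x $ g \<noteq> 0" for x
    using that acts_only_on_nonzeroD [OF U, of f x] acts_only_on_nonzeroD [OF W, of x g] \<open>A \<inter> B = {}\<close>
    by (fastforce simp: h_def)
  then have "(U ** W) $ f $ g = (\<Sum>x\<in>UNIV. if x = h then U $ f $ x * W $ x $ g else 0)"
    unfolding mat_mult_nth by (intro sum.cong) auto
  then have 1: "(U ** W) $ f $ g = U $ f $ h * W $ h $ g"
    by simp
  have "x = k" if "W $ f $ x * U $ x $ g \<noteq> 0" for x
    using that acts_only_on_nonzeroD [OF U, of x g] acts_only_on_nonzeroD [OF W, of f x] \<open>A \<inter> B = {}\<close>
    by (fastforce simp: k_def)
  then have "(W ** U) $ f $ g = (\<Sum>x\<in>UNIV. if x = k then W $ f $ x * U $ x $ g else 0)"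
    unfolding mat_mult_nth by (intro sum.cong) auto
  then have 2: "(W ** U) $ f $ g = W $ f $ k * U $ k $ g"
    by simp
  have "U $ (f + (k - f)) $ (h + (k - f)) = U $ f $ h"
    by (rule acts_only_on_shift [OF U]) (simp add: k_def)
  moreover have "h + (k - f) = g"
    by (auto simp: h_def k_def)
  ultimately have 3: "U $ k $ g = U $ f $ h"
    by simp
  have "W $ (h + (f - h)) $ (g + (f - h)) = W $ h $ g"
    using \<open>A \<inter> B = {}\<close> by (intro acts_only_on_shift [OF W]) (auto simp: h_def)
  moreover have "g + (f - h) = k"
    by (auto simp: h_def k_def)
  ultimately have "W $ f $ k = W $ h $ g"
    by simp
  with 1 2 3 show "(U ** W) $ f $ g = (W ** U) $ f $ g"
    by simp
qed

lemma acts_only_on_weylI: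
  assumes "\<And>i. i \<notin> A \<Longrightarrow> a i = 0 \<and> b i = 0"
  shows "acts_only_on A (weyl a b)"
proof (rule acts_only_onI)
  fix i assume "i \<notin> A"
  then have "a i = 0" "b i = 0"
    using assms by auto
  then show "weyl a b ** pauli_X i = pauli_X i ** weyl a b"
    and "weyl a b ** pauli_Z i = pauli_Z i ** weyl a b"
    using weyl_commutation [of a b "unit_fun i 1" 0] weyl_commutation [of a b 0 "unit_fun i 1"]
    by (simp_all add: pauli_X_eq_weyl pauli_Z_eq_weyl)
qed

lemma acts_only_on_commute_XZ:
  assumes "acts_only_on A U" "i \<notin> A"
  shows "U ** pauli_X i = pauli_X i ** U" "U ** pauli_Z i = pauli_Z i ** U"
  by (rule acts_only_on_commute_disjoint [of A _ "{i}"];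
      use assms in \<open>auto simp: pauli_X_eq_weyl pauli_Z_eq_weyl unit_fun_def intro!: acts_only_on_weylI\<close>)+

lemma acts_only_on_iff:
  "acts_only_on A U \<longleftrightarrow>
     (\<forall>i\<in>-A. U ** pauli_X i = pauli_X i ** U \<and> U ** pauli_Z i = pauli_Z i ** U)"
  using acts_only_onI [of A U] acts_only_on_commute_XZ [of A U] by blast

lemma acts_only_on_mono: "acts_only_on A U \<Longrightarrow> A \<subseteq> B \<Longrightarrow> acts_only_on B U"
  by (auto simp: acts_only_on_iff)

lemma acts_only_on_mult: "acts_only_on A U \<Longrightarrow> acts_only_on A W \<Longrightarrow> acts_only_on A (U ** W)"
  by (simp add: acts_only_on_iff commute_mult)

lemma acts_only_on_dagger: "acts_only_on A U \<Longrightarrow> acts_only_on A (dagger U)"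
  unfolding acts_only_on_iff
  using commute_dagger_both [OF commute_dagger_right, of "pauli_X i" U for i]
    commute_dagger_both [OF commute_dagger_right, of "pauli_Z i" U for i]
  by simp

text \<open>A Pauli commutes with each \<open>pauli_X i\<close> and \<open>pauli_Z i\<close> up to a
  phase, and under conjugation that phase cancels against its conjugate. So Pauli conjugation never
  enlarges a support.\<close>

lemma acts_only_on_conj_pauli:
  assumes "acts_only_on A W" "is_pauli p"
  shows "acts_only_on A (p ** W ** dagger p)"
proof -
  have comm: "(p ** W ** dagger p) ** x = x ** (p ** W ** dagger p)"
    if "is_pauli x" "W ** x = x ** W" for x
  proof -
    obtain c where c: "cmod c = 1" "p ** x = cscale c (x ** p)"
      using is_pauli_commutation [OF assms(2) \<open>is_pauli x\<close>] .
    have "dagger p ** (p ** x) ** dagger p = dagger p ** cscale c (x ** p) ** dagger p"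
      by (simp add: c(2))
    then have d: "x ** dagger p = cscale c (dagger p ** x)"
      using assms(2) by (simp flip: matrix_mul_assoc)
    have "x ** p ** W ** dagger p = cscale (cnj c) (cscale c (x ** p)) ** W ** dagger p"
      using c(1) by simp
    also have "\<dots> = cscale (cnj c) (p ** (x ** W) ** dagger p)"
      by (simp flip: c(2) matrix_mul_assoc)
    also have "\<dots> = cscale (cnj c) (p ** W ** (x ** dagger p))"
      by (simp flip: that(2) add: matrix_mul_assoc)
    also have "\<dots> = p ** W ** dagger p ** x"
      unfolding d using c(1) by (simp add: matrix_mul_assoc)
    finally show ?thesis by (simp add: matrix_mul_assoc)
  qed
  then show ?thesis
    using assms(1) by (simp add: acts_only_on_iff)
qed

lemma acts_only_on_empty:
  fixes U :: "('n::finite, 'm::nontriv) op"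
  assumes "acts_only_on {} U"
  obtains c where "U = cscale c (mat 1)"
proof -
  have "U $ f $ g = cscale (U $ 0 $ 0) (mat 1) $ f $ g" for f g
  proof (cases "f = g")
    case True
    then show ?thesis
      using acts_only_on_shift [OF assms, of f 0 0] by (simp add: mat_def)
  next
    case False
    then show ?thesis
      using acts_only_on_nonzeroD [OF assms, of f g] by (auto simp: mat_def)
  qed
  then show ?thesis
    by (intro that matrix_eqI)
qed

text \<open>The support tests blocks one at a time. The tests combine because the commutation
  criterion looks at a single qudit, which lies in a single block.\<close>

lemma acts_only_on_Union_supp:
  assumes "partition_on UNIV Q"
  shows "acts_only_on (\<Union>(supp Q U)) U"
  unfolding acts_only_on_iff
proof
  fix i assume i: "i \<in> - \<Union>(supp Q U)"
  obtain B where "B \<in> Q" "i \<in> B"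
    using assms unfolding partition_on_def by blast
  then have "acts_only_on (- B) U"
    using i by (auto simp: supp_def)
  then show "U ** pauli_X i = pauli_X i ** U \<and> U ** pauli_Z i = pauli_Z i ** U"
    using \<open>i \<in> B\<close> by (auto dest: acts_only_on_commute_XZ)
qed

lemma supp_subset:
  assumes "partition_on UNIV Q" "acts_only_on (\<Union>A) U" "A \<subseteq> Q"
  shows "supp Q U \<subseteq> A"
proof
  fix B assume B: "B \<in> supp Q U"
  show "B \<in> A"
  proof (rule ccontr)
    assume "B \<notin> A"
    then have "\<Union>A \<subseteq> - B"
      using assms(1,3) B by (fastforce simp: supp_def partition_on_def disjoint_def)
    with acts_only_on_mono [OF assms(2)] B show False
      by (simp add: supp_def)
  qed
qed

lemma is_pauli_noncommuting:
  assumes "is_pauli p" "B \<in> supp Q p"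
  obtains i x c where "i \<in> B" "x = pauli_X i \<or> x = pauli_Z i" "p ** x = cscale c (x ** p)" "c \<noteq> 1"
proof -
  obtain i x where "i \<in> B" and x: "x = pauli_X i \<or> x = pauli_Z i" "p ** x \<noteq> x ** p"
    using assms(2) by (fastforce simp: supp_def acts_only_on_iff)
  have "is_pauli x"
    using x(1) by auto
  then obtain c where "p ** x = cscale c (x ** p)"
    using is_pauli_commutation [OF assms(1)] by blast
  with x that \<open>i \<in> B\<close> show ?thesis
    by (cases "c = 1") auto
qed

lemma trace_cscale [simp]: "trace (cscale c A) = c * trace A"
  by (simp add: trace_def sum_distrib_left)

text \<open>On a block where \<open>p\<close> acts and \<open>U\<close> does not, some
  \<open>X\<close> or \<open>Z\<close> operator commutes with \<open>U\<close> but only up to a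
  phase other than 1 with \<open>p\<close>. Conjugating by it under the trace multiplies the trace
  by a nontrivial factor.\<close>

lemma trace_dagger_pauli_zero:
  assumes "is_pauli p" "\<not> supp Q p \<subseteq> supp Q U"
  shows "trace (dagger p ** U) = 0"
proof -
  obtain B where B: "B \<in> supp Q p" "B \<notin> supp Q U"
    using assms(2) by auto
  obtain i x c where i: "i \<in> B" and x: "x = pauli_X i \<or> x = pauli_Z i"
    and c: "p ** x = cscale c (x ** p)" "c \<noteq> 1"
    using is_pauli_noncommuting [OF assms(1) B(1)] .
  have u: "unitary x"
    using x by auto
  have "acts_only_on (- B) U"
    using B by (auto simp: supp_def)
  then have comm: "U ** x = x ** U"
    using x i by (auto dest: acts_only_on_commute_XZ)
  have "dagger x ** dagger p = cscale (cnj c) (dagger p ** dagger x)"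
    using arg_cong [OF c(1), of dagger] by (simp add: dagger_mult)
  then have "x ** (dagger x ** dagger p) = cscale (cnj c) (x ** (dagger p ** dagger x))"
    by simp
  then have "dagger p = cscale (cnj c) (x ** (dagger p ** dagger x))"
    using u by simp
  then have "dagger p ** U = cscale (cnj c) (x ** (dagger p ** dagger x)) ** U"
    by (rule arg_cong)
  then have "trace (dagger p ** U) = cnj c * trace (x ** (dagger p ** dagger x ** U))"
    by (simp add: matrix_mul_assoc)
  also have "trace (x ** (dagger p ** dagger x ** U)) = trace (dagger p ** dagger x ** U ** x)"
    by (rule trace_mul_sym)
  also have "dagger p ** dagger x ** U ** x = dagger p ** U"
    using u by (simp add: comm flip: matrix_mul_assoc)
  finally show ?thesis
    using c(2) by (metis complex_cnj_cnj complex_cnj_one mult_cancel_right1)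
qed

section \<open>Light cones\<close>

text \<open>A light cone bound in the Heisenberg picture. The cone \<open>A'\<close> depends on
  \<open>A\<close> only, and it contains \<open>A\<close> because a commutator also has a factor
  that is not conjugated by \<open>U\<close>.\<close>

definition spreads :: "'n::finite set set \<Rightarrow> nat \<Rightarrow> ('n, 'm::nontriv) op \<Rightarrow> bool" where
  "spreads Q r U \<longleftrightarrow> (\<forall>A\<subseteq>Q. \<exists>A'. A \<subseteq> A' \<and> A' \<subseteq> Q \<and> card A' \<le> r * card A \<and>
     (\<forall>K. acts_only_on (\<Union>A) K \<longrightarrow> acts_only_on (\<Union>A') (U ** K ** dagger U)))"

lemma spreads_mat_1: "spreads Q 1 (mat 1)"
  unfolding spreads_def by auto

lemma spreads_mult:
  assumes "spreads Q r U" "spreads Q s W"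
  shows "spreads Q (r * s) (U ** W)"
  unfolding spreads_def
proof (intro allI impI)
  fix A assume "A \<subseteq> Q"
  then obtain A' where A': "A \<subseteq> A'" "A' \<subseteq> Q" "card A' \<le> s * card A"
    "\<And>K. acts_only_on (\<Union>A) K \<Longrightarrow> acts_only_on (\<Union>A') (W ** K ** dagger W)"
    using assms(2) unfolding spreads_def by metis
  then obtain A'' where A'': "A' \<subseteq> A''" "A'' \<subseteq> Q" "card A'' \<le> r * card A'"
    "\<And>K. acts_only_on (\<Union>A') K \<Longrightarrow> acts_only_on (\<Union>A'') (U ** K ** dagger U)"
    using assms(1) unfolding spreads_def by metis
  have "card A'' \<le> r * s * card A"
    using A''(3) mult_le_mono2 [OF A'(3), of r] by (simp only: mult.assoc)
  moreover have "acts_only_on (\<Union>A'') (U ** W ** K ** dagger (U ** W))"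
    if "acts_only_on (\<Union>A) K" for K
    using A''(4) [OF A'(4) [OF that]] by (simp add: dagger_mult matrix_mul_assoc)
  ultimately show "\<exists>A'. A \<subseteq> A' \<and> A' \<subseteq> Q \<and> card A' \<le> r * s * card A \<and>
     (\<forall>K. acts_only_on (\<Union>A) K \<longrightarrow> acts_only_on (\<Union>A') (U ** W ** K ** dagger (U ** W)))"
    using A' A'' by (intro exI [of _ A'']) auto
qed

section \<open>Layers of depth one\<close>

lemma transversalE:
  assumes "transversal P U" "partition_on UNIV P"
  obtains W where "\<And>R. R \<in> P \<Longrightarrow> unitary (W R)" "\<And>R. R \<in> P \<Longrightarrow> acts_only_on R (W R)"
    "U = comm_prod W P"
    "\<And>R R'. R \<in> P \<Longrightarrow> R' \<in> P \<Longrightarrow> R \<noteq> R' \<Longrightarrow> W R ** W R' = W R' ** W R"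
proof -
  obtain W where W: "\<And>R. R \<in> P \<Longrightarrow> unitary (W R)" "\<And>R. R \<in> P \<Longrightarrow> acts_only_on R (W R)"
    "U = comm_prod W P"
    using assms(1) unfolding transversal_def by auto
  moreover have "W R ** W R' = W R' ** W R" if "R \<in> P" "R' \<in> P" "R \<noteq> R'" for R R'
    by (rule acts_only_on_commute_disjoint [of R _ R'])
      (use W that assms(2) in \<open>auto simp: partition_on_def disjoint_def\<close>)
  ultimately show ?thesis by (rule that)
qed

lemma transversal_unitary:
  assumes "transversal P U" "partition_on UNIV P"
  shows "unitary U"
  by (rule transversalE [OF assms]) (simp add: comm_prod_unitary)

lemma transversal_dagger:
  assumes "transversal P U" "partition_on UNIV P"
  shows "transversal P (dagger U)"
proof -
  obtain W where W: "\<And>R. R \<in> P \<Longrightarrow> unitary (W R)" "\<And>R. R \<in> P \<Longrightarrow> acts_only_on R (W R)"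
    "U = comm_prod W P"
    "\<And>R R'. R \<in> P \<Longrightarrow> R' \<in> P \<Longrightarrow> R \<noteq> R' \<Longrightarrow> W R ** W R' = W R' ** W R"
    using transversalE [OF assms] by metis
  then have "dagger U = comm_prod (\<lambda>R. dagger (W R)) P"
    by (simp add: comm_prod_dagger)
  with W show ?thesis
    unfolding transversal_def by (intro exI [of _ "\<lambda>R. dagger (W R)"]) (auto intro: acts_only_on_dagger)
qed

lemma transversal_conj_pauli:
  assumes "transversal P U" "partition_on UNIV P" "is_pauli p"
  shows "transversal P (p ** U ** dagger p)"
proof -
  obtain W where W: "\<And>R. R \<in> P \<Longrightarrow> unitary (W R)" "\<And>R. R \<in> P \<Longrightarrow> acts_only_on R (W R)"
    "U = comm_prod W P"
    "\<And>R R'. R \<in> P \<Longrightarrow> R' \<in> P \<Longrightarrow> R \<noteq> R' \<Longrightarrow> W R ** W R' = W R' ** W R"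
    using transversalE [OF assms(1,2)] by metis
  then have "p ** U ** dagger p = comm_prod (\<lambda>R. p ** W R ** dagger p) P"
    using assms(3) by (simp add: comm_prod_conj)
  with W assms(3) show ?thesis
    unfolding transversal_def
    by (intro exI [of _ "\<lambda>R. p ** W R ** dagger p"]) (auto intro: acts_only_on_conj_pauli)
qed

lemma local_depth_one_unitary: "local_depth_one Q q U \<Longrightarrow> unitary U"
  unfolding local_depth_one_def by (auto intro: transversal_unitary)

lemma local_depth_one_dagger: "local_depth_one Q q U \<Longrightarrow> local_depth_one Q q (dagger U)"
  unfolding local_depth_one_def by (blast intro: transversal_dagger)

lemma local_depth_one_conj_pauli:
  "local_depth_one Q q U \<Longrightarrow> is_pauli p \<Longrightarrow> local_depth_one Q q (p ** U ** dagger p)"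
  unfolding local_depth_one_def by (blast intro: transversal_conj_pauli)

text \<open>The cone collects the blocks of all parts of \<open>P\<close> that contain a block of
  \<open>A\<close>. A factor on such a part stays inside the cone, and any other factor commutes
  with what is inside and cancels.\<close>

lemma local_depth_one_spreads:
  assumes Q: "partition_on UNIV Q" and U: "local_depth_one Q q U"
  shows "spreads Q q U"
  unfolding spreads_def
proof (intro allI impI)
  fix A assume "A \<subseteq> Q"
  obtain P where P: "partition_on UNIV P" "transversal P U"
    and coarse: "\<forall>R\<in>P. \<exists>B. B \<subseteq> Q \<and> card B \<le> q \<and> R = \<Union>B"
    using U unfolding local_depth_one_def by blast
  obtain W where W: "\<And>R. R \<in> P \<Longrightarrow> unitary (W R)" "\<And>R. R \<in> P \<Longrightarrow> acts_only_on R (W R)"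
    "U = comm_prod W P"
    "\<And>R R'. R \<in> P \<Longrightarrow> R' \<in> P \<Longrightarrow> R \<noteq> R' \<Longrightarrow> W R ** W R' = W R' ** W R"
    using transversalE [OF P(2,1)] by metis
  obtain \<beta> where \<beta>: "\<And>R. R \<in> P \<Longrightarrow> \<beta> R \<subseteq> Q \<and> card (\<beta> R) \<le> q \<and> R = \<Union>(\<beta> R)"
    using coarse by metis
  \<comment> \<open>No block straddles two parts: every part is a union of blocks, and a block
    sharing a qudit with one of these equals it.\<close>
  have "\<exists>R. R \<in> P \<and> B \<in> \<beta> R" if "B \<in> Q" for B
  proof -
    obtain i where "i \<in> B"
      using Q \<open>B \<in> Q\<close> by (metis all_not_in_conv partition_on_def)
    obtain R where "R \<in> P" "i \<in> R"
      using P(1) unfolding partition_on_def by blast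
    then obtain B' where "B' \<in> \<beta> R" "i \<in> B'"
      using \<beta> by blast
    then have "B' = B"
      using \<open>i \<in> B\<close> \<open>B \<in> Q\<close> Q \<beta> [OF \<open>R \<in> P\<close>] unfolding partition_on_def disjoint_def by blast
    then show ?thesis using \<open>R \<in> P\<close> \<open>B' \<in> \<beta> R\<close> by blast
  qed
  then obtain \<rho> where \<rho>: "\<And>B. B \<in> Q \<Longrightarrow> \<rho> B \<in> P \<and> B \<in> \<beta> (\<rho> B)"
    by metis
  define A' where "A' = (\<Union>B\<in>A. \<beta> (\<rho> B))"
  have "card A' \<le> (\<Sum>B\<in>A. card (\<beta> (\<rho> B)))"
    unfolding A'_def by (intro card_UN_le) simp
  also have "\<dots> \<le> q * card A"
    using sum_bounded_above [of A "\<lambda>B. card (\<beta> (\<rho> B))" q] \<beta> \<rho> \<open>A \<subseteq> Q\<close> by (auto simp: mult.commute)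
  finally have "card A' \<le> q * card A" .
  moreover have "A \<subseteq> A'"
    using \<rho> \<open>A \<subseteq> Q\<close> unfolding A'_def by blast
  moreover have "\<beta> (\<rho> B) \<subseteq> Q" if "B \<in> A" for B
    using \<rho> \<beta> \<open>A \<subseteq> Q\<close> that by blast
  then have "A' \<subseteq> Q"
    unfolding A'_def by blast
  moreover have "acts_only_on (\<Union>A') (U ** K ** dagger U)" if K: "acts_only_on (\<Union>A) K" for K
  proof -
    \<comment> \<open>The cone is itself a union of parts, so no factor of the layer can cross its
      boundary.\<close>
    have dichotomy: "R \<subseteq> \<Union>A' \<or> R \<inter> \<Union>A' = {}" if "R \<in> P" for R
    proof (cases "\<exists>B\<in>A. \<rho> B = R")
      case True
      then show ?thesis
        using \<beta> [OF that] unfolding A'_def by blast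
    next
      case False
      have "R \<inter> \<rho> B = {}" if "B \<in> A" for B
      proof -
        have "\<rho> B \<in> P" "R \<noteq> \<rho> B"
          using False that \<rho> \<open>A \<subseteq> Q\<close> by auto
        then show ?thesis
          using P(1) \<open>R \<in> P\<close> unfolding partition_on_def disjoint_def by metis
      qed
      moreover have "\<Union>(\<beta> (\<rho> B)) = \<rho> B" if "B \<in> A" for B
        using \<beta> [of "\<rho> B"] \<rho> that \<open>A \<subseteq> Q\<close> by blast
      ultimately show ?thesis
        unfolding A'_def by blast
    qed
    \<comment> \<open>Generalised to partial products, so that the factors can be added one by
      one.\<close>
    have "acts_only_on (\<Union>A') (comm_prod W F ** K ** dagger (comm_prod W F))" if "F \<subseteq> P" for F
      using finite [of F] that
    proof (induction F)
      case empty
      then show ?case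
        using acts_only_on_mono [OF K Union_mono [OF \<open>A \<subseteq> A'\<close>]] by simp
    next
      case (insert R F)
      let ?K = "comm_prod W F ** K ** dagger (comm_prod W F)"
      have K': "acts_only_on (\<Union>A') ?K"
        using insert by auto
      have "comm_prod W (insert R F) = W R ** comm_prod W F"
        by (rule comm_prod_insert) (use insert W(4) in auto)
      then have eq: "comm_prod W (insert R F) ** K ** dagger (comm_prod W (insert R F))
          = W R ** ?K ** dagger (W R)"
        by (simp add: dagger_mult matrix_mul_assoc)
      show ?case
      proof (cases "R \<subseteq> \<Union>A'")
        case True
        then have "acts_only_on (\<Union>A') (W R)"
          using acts_only_on_mono [OF W(2)] insert by auto
        then show ?thesis
          unfolding eq using K' by (simp add: acts_only_on_mult acts_only_on_dagger)
      next
        case False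
        then have "R \<inter> \<Union>A' = {}"
          using dichotomy insert by auto
        then have "W R ** ?K = ?K ** W R"
          using acts_only_on_commute_disjoint [OF W(2) K'] insert by auto
        then have "W R ** ?K ** dagger (W R) = ?K"
          using W(1) insert by (simp flip: matrix_mul_assoc)
        with K' show ?thesis
          unfolding eq by simp
      qed
    qed
    then show ?thesis
      using W(3) by simp
  qed
  ultimately show "\<exists>A'. A \<subseteq> A' \<and> A' \<subseteq> Q \<and> card A' \<le> q * card A \<and>
     (\<forall>K. acts_only_on (\<Union>A) K \<longrightarrow> acts_only_on (\<Union>A') (U ** K ** dagger U))"
    by blast
qed

section \<open>Circuits of several layers\<close>

lemma local_circuit_0 [simp]: "local_circuit Q q 0 U \<longleftrightarrow> U = mat 1"
  by (auto simp: local_circuit_def)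

lemma local_circuit_Suc:
  "local_circuit Q q (Suc h) U \<longleftrightarrow>
     (\<exists>T W. local_depth_one Q q T \<and> local_circuit Q q h W \<and> U = T ** W)"
proof
  assume "local_circuit Q q (Suc h) U"
  then obtain T Ts where "length Ts = h" "\<forall>T\<in>set (T # Ts). local_depth_one Q q T"
    "U = foldr (**) (T # Ts) (mat 1)"
    unfolding local_circuit_def length_Suc_conv by blast
  then show "\<exists>T W. local_depth_one Q q T \<and> local_circuit Q q h W \<and> U = T ** W"
    unfolding local_circuit_def by auto
next
  assume "\<exists>T W. local_depth_one Q q T \<and> local_circuit Q q h W \<and> U = T ** W"
  then obtain T Ts where "length Ts = h" "local_depth_one Q q T" "\<forall>T\<in>set Ts. local_depth_one Q q T"
    "U = T ** foldr (**) Ts (mat 1)"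
    unfolding local_circuit_def by auto
  then show "local_circuit Q q (Suc h) U"
    unfolding local_circuit_def by (intro exI [of _ "T # Ts"]) auto
qed

lemma local_circuit_unitary: "local_circuit Q q h U \<Longrightarrow> unitary U"
  by (induction h arbitrary: U) (auto simp: local_circuit_Suc local_depth_one_unitary)

lemma local_circuit_spreads:
  "partition_on UNIV Q \<Longrightarrow> local_circuit Q q h U \<Longrightarrow> spreads Q (q ^ h) U"
proof (induction h arbitrary: U)
  case 0
  then show ?case
    using spreads_mat_1 [of Q] by simp
next
  case (Suc h)
  then show ?case
    by (auto simp: local_circuit_Suc intro: spreads_mult local_depth_one_spreads)
qed

lemma local_circuit_mult:
  "local_circuit Q q h U \<Longrightarrow> local_circuit Q q k W \<Longrightarrow> local_circuit Q q (h + k) (U ** W)"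
proof (induction h arbitrary: U)
  case (Suc h)
  then obtain T V where "local_depth_one Q q T" "local_circuit Q q h V" "U = T ** V"
    by (auto simp: local_circuit_Suc)
  with Suc show ?case
    by (auto simp: local_circuit_Suc simp flip: matrix_mul_assoc)
qed simp

lemma local_circuit_1: "local_depth_one Q q U \<Longrightarrow> local_circuit Q q 1 U"
  by (simp add: local_circuit_Suc)

lemma local_circuit_dagger: "local_circuit Q q h U \<Longrightarrow> local_circuit Q q h (dagger U)"
proof (induction h arbitrary: U)
  case (Suc h)
  then obtain T V where T: "local_depth_one Q q T" and V: "local_circuit Q q h V" and U: "U = T ** V"
    by (auto simp: local_circuit_Suc)
  from local_circuit_mult [OF Suc.IH [OF V] local_circuit_1 [OF local_depth_one_dagger [OF T]]]
  show ?case
    by (simp add: U dagger_mult)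
qed simp

lemma local_circuit_conj_pauli:
  "local_circuit Q q h U \<Longrightarrow> is_pauli p \<Longrightarrow> local_circuit Q q h (p ** U ** dagger p)"
proof (induction h arbitrary: U)
  case (Suc h)
  then obtain T V where T: "local_depth_one Q q T" and V: "local_circuit Q q h V" and U: "U = T ** V"
    by (auto simp: local_circuit_Suc)
  have "p ** U ** dagger p = (p ** T ** dagger p) ** (p ** V ** dagger p)"
    using Suc.prems(2) by (simp add: U flip: matrix_mul_assoc)
  then show ?case
    using local_depth_one_conj_pauli [OF T] Suc.IH [OF V] Suc.prems(2)
    unfolding local_circuit_Suc by blast
qed simp

text \<open>Grouped as \<open>U\<close> times the conjugate of \<open>dagger U\<close> by
  \<open>p\<close>: Pauli conjugation preserves each layer, so \<open>p\<close> costs no depth of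
  its own and the depth exactly doubles.\<close>

lemma local_circuit_gcomm:
  assumes "local_circuit Q q h U" "is_pauli p"
  shows "local_circuit Q q (2 * h) (gcomm U p)"
proof -
  have "gcomm U p = U ** (p ** dagger U ** dagger p)"
    by (simp add: gcomm_def matrix_mul_assoc)
  then show ?thesis
    using local_circuit_mult [OF assms(1) local_circuit_conj_pauli [OF local_circuit_dagger]] assms
    by (simp add: mult_2)
qed

text \<open>Commutation with \<open>pauli_X i\<close> exposes \<open>b i\<close>, and commutation
  with \<open>pauli_Z i\<close> exposes \<open>a i\<close>, each through the faithful
  character.\<close>

lemma acts_only_on_weylD:
  assumes "acts_only_on A (cscale c (weyl a b))" "cmod c = 1" "i \<notin> A"
  shows "a i = 0" "b i = 0"
proof -
  have c: "c \<noteq> 0"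
    using assms(2) by auto
  have cancel: "A = B" if "cscale c A = cscale c B" for A B :: "('a, 'b) op"
    using arg_cong [OF that, of "cscale (inverse c)"] c by simp
  have "weyl a b ** pauli_X i = pauli_X i ** weyl a b" "weyl a b ** pauli_Z i = pauli_Z i ** weyl a b"
    using acts_only_on_commute_XZ [OF assms(1,3)] by (auto intro: cancel)
  then have "cscale (chi (b i)) (pauli_X i ** weyl a b) = pauli_X i ** weyl a b"
    "cscale (chi (- a i)) (pauli_Z i ** weyl a b) = pauli_Z i ** weyl a b"
    using weyl_commutation [of a b "unit_fun i 1" 0] weyl_commutation [of a b 0 "unit_fun i 1"]
    by (simp_all add: pauli_X_eq_weyl pauli_Z_eq_weyl)
  then show "a i = 0" "b i = 0"
    by (simp_all add: cscale_eq_self_iff)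
qed

lemma card_supp_gcomm_le:
  assumes Q: "partition_on UNIV Q" and U: "unitary U" "spreads Q r U" and p: "is_pauli p"
  shows "card (supp Q (gcomm U p)) \<le> r * card (supp Q U \<inter> supp Q p)"
proof -
  define A where "A = supp Q U \<inter> supp Q p"
  have "A \<subseteq> Q"
    by (auto simp: A_def supp_def)
  then obtain A' where A': "A \<subseteq> A'" "A' \<subseteq> Q" "card A' \<le> r * card A"
    "\<And>K. acts_only_on (\<Union>A) K \<Longrightarrow> acts_only_on (\<Union>A') (U ** K ** dagger U)"
    using U(2) unfolding spreads_def by metis
  obtain c a b where c: "cmod c = 1" and p_eq: "p = cscale c (weyl a b)"
    using p by (rule is_pauliE)
  \<comment> \<open>Cutting both exponent vectors to the overlap \<open>A\<close> factors
    \<open>p\<close> up to its phase. The factorisation creates no further phase, since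
    \<open>cut b\<close> and \<open>a - cut a\<close> live on disjoint sets of qudits.\<close>
  define cut where "cut = (\<lambda>x :: 'a \<Rightarrow> 'b mod_ring. \<lambda>i. if i \<in> \<Union>A then x i else 0)"
  let ?w1 = "weyl (cut a) (cut b)" and ?w2 = "weyl (a - cut a) (b - cut b)"
  have "cut b i * (a - cut a) i = 0" for i
    by (simp add: cut_def)
  then have "dot (cut b) (a - cut a) = 0"
    unfolding dot_def by (intro sum.neutral) blast
  then have "?w1 ** ?w2 = weyl a b"
    by (simp add: weyl_mult del: dot_simps)
  then have "gcomm U p = gcomm U (?w1 ** ?w2)"
    using c by (simp add: p_eq gcomm_cscale)
  also have "\<dots> = U ** ?w1 ** dagger U ** dagger ?w1"
  proof -
    have "a i = 0 \<and> b i = 0" if "i \<in> \<Union>(supp Q U)" "i \<notin> \<Union>A" for i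
    proof -
      obtain B where B: "B \<in> supp Q U" "i \<in> B"
        using \<open>i \<in> \<Union>(supp Q U)\<close> by blast
      then have "B \<in> Q" "B \<notin> supp Q p"
        using \<open>i \<notin> \<Union>A\<close> by (auto simp: A_def supp_def)
      then have "acts_only_on (- B) p"
        by (simp add: supp_def)
      then show ?thesis
        unfolding p_eq using acts_only_on_weylD [of "- B" c a b i] c \<open>i \<in> B\<close> by simp
    qed
    then have "acts_only_on (- \<Union>(supp Q U)) ?w2"
      by (intro acts_only_on_weylI) (auto simp: cut_def)
    moreover have "acts_only_on (\<Union>(supp Q U)) (dagger U)"
      by (intro acts_only_on_dagger acts_only_on_Union_supp Q)
    ultimately have comm: "?w2 ** dagger U = dagger U ** ?w2"
      by (intro acts_only_on_commute_disjoint) auto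
    \<comment> \<open>Once \<open>?w2\<close> has moved past \<open>dagger U\<close> it meets its
      own dagger, and only \<open>?w1\<close> remains to be spread by \<open>U\<close>.\<close>
    have "gcomm U (?w1 ** ?w2) = U ** (?w1 ** (?w2 ** dagger U ** dagger ?w2 ** dagger ?w1))"
      by (simp add: gcomm_def dagger_mult flip: matrix_mul_assoc)
    then show ?thesis
      unfolding comm by (simp flip: matrix_mul_assoc)
  qed
  finally have eq: "gcomm U p = U ** ?w1 ** dagger U ** dagger ?w1" .
  have w1: "acts_only_on (\<Union>A) ?w1"
    by (intro acts_only_on_weylI) (simp add: cut_def)
  have "\<Union>A \<subseteq> \<Union>A'"
    using A'(1) by auto
  then have "acts_only_on (\<Union>A') (gcomm U p)"
    unfolding eq
    by (intro acts_only_on_mult A'(4) w1 acts_only_on_mono [OF acts_only_on_dagger [OF w1]])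
  then have "supp Q (gcomm U p) \<subseteq> A'"
    using Q A'(2) by (intro supp_subset)
  then have "card (supp Q (gcomm U p)) \<le> card A'"
    by (intro card_mono) auto
  with A'(3) show ?thesis
    by (simp add: A_def)
qed

section \<open>Distances and disjointness\<close>

lemma dist_coset_attained:
  assumes "finite G" "G \<noteq> {}"
  obtains g where "g \<in> G" "card (supp Q g) = dist_coset Q G"
proof -
  have "dist_coset Q G \<in> (\<lambda>g. card (supp Q g)) ` G"
    unfolding dist_coset_def using assms by (intro Min_in) auto
  then show ?thesis using that by auto
qed

lemma min_distance_le:
  assumes "finite L" "G \<in> L" "finite G" "g \<in> G"
  shows "min_distance Q L \<le> card (supp Q g)"
proof -
  have "min_distance Q L \<le> dist_coset Q G"
    unfolding min_distance_def using assms by (intro Min_le) auto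
  also have "\<dots> \<le> card (supp Q g)"
    unfolding dist_coset_def using assms by (intro Min_le) auto
  finally show ?thesis .
qed

lemma max_distance_ge:
  assumes "finite L" "G \<in> L"
  shows "dist_coset Q G \<le> max_distance Q L"
  unfolding max_distance_def using assms by (intro Max_ge) auto

lemma c_disjointness_attained:
  assumes "finite G"
  obtains A where "A \<subseteq> G" "c_disjoint Q c A" "c_disjointness Q c G = real (card A) / real c"
proof -
  let ?F = "{A. A \<subseteq> G \<and> c_disjoint Q c A}"
  have "{} \<in> ?F"
    by (simp add: c_disjoint_def)
  then have "Max (card ` ?F) \<in> card ` ?F"
    using assms by (intro Max_in) auto
  then show ?thesis
    using that by (auto simp: c_disjointness_def)
qed

text \<open>Double counting of the pairs of an element of \<open>A\<close> and a block of
  \<open>T\<close> in its support.\<close>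

lemma c_disjoint_overlap:
  assumes "finite A" "finite T" "T \<subseteq> Q" "c_disjoint Q c A"
    and r: "\<And>a. a \<in> A \<Longrightarrow> r \<le> card (T \<inter> supp Q a)"
  shows "card A * r \<le> c * card T"
proof -
  have "card A * r \<le> (\<Sum>a\<in>A. card (T \<inter> supp Q a))"
    using sum_bounded_below [of A r "\<lambda>a. card (T \<inter> supp Q a)"] r by simp
  also have "\<dots> = (\<Sum>a\<in>A. \<Sum>B\<in>T. if B \<in> supp Q a then 1 else 0)"
    using assms(2) by (intro sum.cong) (simp_all add: sum.If_cases Int_def)
  also have "\<dots> = (\<Sum>B\<in>T. \<Sum>a\<in>A. if B \<in> supp Q a then 1 else 0)"
    by (rule sum.swap)
  also have "\<dots> = (\<Sum>B\<in>T. card {a \<in> A. B \<in> supp Q a})"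
    using assms(1) by (intro sum.cong) (simp_all add: sum.If_cases Int_def)
  also have "\<dots> \<le> c * card T"
    using sum_bounded_above [of T "\<lambda>B. card {a \<in> A. B \<in> supp Q a}" c] assms(3,4)
    by (auto simp: c_disjoint_def mult.commute)
  finally show ?thesis .
qed

text \<open>These bounds make the supremum in \<open>disjointness\<close> one of a bounded set of
  nonnegative reals, hence well behaved.\<close>

lemma Min_c_disjointness_bounds:
  assumes "finite L" "G \<in> L" "\<And>G. G \<in> L \<Longrightarrow> finite G" "c \<ge> 1"
  shows "0 \<le> Min (c_disjointness Q c ` L)" "Min (c_disjointness Q c ` L) \<le> real (card G)"
proof -
  show "0 \<le> Min (c_disjointness Q c ` L)"
    using assms(1,2) by (subst Min_ge_iff) (auto simp: c_disjointness_def)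
  obtain A where A: "A \<subseteq> G" "c_disjointness Q c G = real (card A) / real c"
    using c_disjointness_attained assms(2,3) by metis
  have "real (card A) / real c \<le> real (card A)"
    using assms(4) mult_left_mono [of 1 "real c" "real (card A)"] by (simp add: divide_le_eq)
  also have "\<dots> \<le> real (card G)"
    using A(1) assms(2,3) by (simp add: card_mono)
  finally have "c_disjointness Q c G \<le> real (card G)"
    by (simp add: A(2))
  moreover have "Min (c_disjointness Q c ` L) \<le> c_disjointness Q c G"
    using assms(1,2) by (intro Min_le) auto
  ultimately show "Min (c_disjointness Q c ` L) \<le> real (card G)"
    by linarith
qed

lemma disjointness_nonneg:
  assumes "finite L" "L \<noteq> {}" "\<And>G. G \<in> L \<Longrightarrow> finite G"
  shows "0 \<le> disjointness Q L"
proof -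
  obtain G where "G \<in> L"
    using assms(2) by auto
  then have "bdd_above ((\<lambda>c. Min (c_disjointness Q c ` L)) ` {1..})"
    using Min_c_disjointness_bounds(2) assms by (intro bdd_aboveI [of _ "real (card G)"]) auto
  then have "Min (c_disjointness Q 1 ` L) \<le> disjointness Q L"
    unfolding disjointness_def by (intro cSUP_upper) auto
  then show ?thesis
    using Min_c_disjointness_bounds(1) [OF assms(1) \<open>G \<in> L\<close> assms(3), of 1 Q] by simp
qed

text \<open>A representative with minimal overlap with \<open>T\<close> works for every \<open>c\<close> simultaneously, so that
  attainment of the supremum in the disjointness plays no role.\<close>

lemma scrubbing:
  assumes "finite L" "G \<in> L" "\<And>G. G \<in> L \<Longrightarrow> finite G" "G \<noteq> {}" "finite T" "T \<subseteq> Q"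
  obtains g where "g \<in> G" "real (card (T \<inter> supp Q g)) * disjointness Q L \<le> real (card T)"
proof -
  define r where "r = Min ((\<lambda>g. card (T \<inter> supp Q g)) ` G)"
  have fin: "finite G"
    using assms by auto
  have "r \<in> (\<lambda>g. card (T \<inter> supp Q g)) ` G"
    unfolding r_def using fin assms(4) by (intro Min_in) auto
  then obtain g where g: "g \<in> G" "card (T \<inter> supp Q g) = r"
    by auto
  have r_le: "r \<le> card (T \<inter> supp Q a)" if "a \<in> G" for a
    unfolding r_def using fin that by (intro Min_le) auto
  have "real r * disjointness Q L \<le> real (card T)"
  proof (cases "r = 0")
    case False
    have "Min (c_disjointness Q c ` L) \<le> real (card T) / real r" if "c \<in> {1..}" for c
    proof -
      obtain A where A: "A \<subseteq> G" "c_disjoint Q c A" "c_disjointness Q c G = real (card A) / real c"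
        using c_disjointness_attained [OF fin] by metis
      have "card A * r \<le> c * card T"
        using A fin assms(5,6) r_le by (intro c_disjoint_overlap) (auto intro: finite_subset)
      then have "real (card A) * real r \<le> real c * real (card T)"
        by (metis of_nat_le_iff of_nat_mult)
      then have "c_disjointness Q c G \<le> real (card T) / real r"
        unfolding A(3) using that False by (simp add: field_simps)
      moreover have "Min (c_disjointness Q c ` L) \<le> c_disjointness Q c G"
        using assms(1,2) by (intro Min_le) auto
      ultimately show ?thesis by linarith
    qed
    then have "disjointness Q L \<le> real (card T) / real r"
      unfolding disjointness_def by (intro cSUP_least) auto
    with False show ?thesis
      by (simp add: field_simps)
  qed simp
  with g that show ?thesis by metis
qed

section \<open>Fourier inversion for Weyl operators\<close>

text \<open>Character orthogonality: shifting \<open>b\<close> along a coordinate where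
  \<open>d\<close> is nonzero multiplies the sum by a factor other than 1.\<close>

lemma sum_chi_dot:
  fixes d :: "'n::finite \<Rightarrow> 'm::nontriv mod_ring"
  shows "(\<Sum>b\<in>UNIV. chi (dot b d)) = (if d = 0 then of_nat CARD('n \<Rightarrow> 'm mod_ring) else 0)"
proof (cases "d = 0")
  case False
  then obtain i where i: "d i \<noteq> 0"
    by (auto simp: fun_eq_iff)
  have "(\<Sum>b\<in>UNIV. chi (dot b d)) = (\<Sum>b\<in>UNIV. chi (dot (b + unit_fun i 1) d))"
    by (rule sum.reindex_bij_witness [of _ "\<lambda>b. b + unit_fun i 1" "\<lambda>b. b - unit_fun i 1"]) auto
  also have "\<dots> = chi (d i) * (\<Sum>b\<in>UNIV. chi (dot b d))"
    by (simp add: chi_add sum_distrib_left mult.commute)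
  finally show ?thesis
    using i False by (metis chi_eq_1_iff mult_cancel_right1)
qed simp

lemma trace_dagger_weyl:
  "trace (dagger (weyl a b) ** W) = (\<Sum>g\<in>UNIV. chi (- dot b g) * W $ (g + a) $ g)"
proof -
  have "(dagger (weyl a b) ** W) $ g $ g = chi (- dot b g) * W $ (g + a) $ g" for g
  proof -
    have "(dagger (weyl a b) ** W) $ g $ g
        = (\<Sum>h\<in>UNIV. if h = g + a then chi (- dot b g) * W $ h $ g else 0)"
      unfolding mat_mult_nth by (rule sum.cong) (auto simp: weyl_nth)
    then show ?thesis by simp
  qed
  then show ?thesis
    by (simp add: trace_def)
qed

text \<open>The traces are the coefficients of \<open>W\<close> in the Weyl basis, so only the
  identity component is left.\<close>

lemma scalar_if_trace_zero:
  fixes W :: "('n::finite, 'm::nontriv) op"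
  assumes "\<And>a b. a \<noteq> 0 \<or> b \<noteq> 0 \<Longrightarrow> trace (dagger (weyl a b) ** W) = 0"
  obtains c where "W = cscale c (mat 1)"
proof -
  define N where "N = (of_nat CARD('n \<Rightarrow> 'm mod_ring) :: complex)"
  have "N \<noteq> 0"
    unfolding N_def by (simp only: of_nat_eq_0_iff) simp
  define F where "F a b = trace (dagger (weyl a b) ** W)" for a b
  \<comment> \<open>For fixed \<open>a\<close>, the map \<open>F a\<close> is the finite Fourier
    transform of the diagonal of \<open>W\<close> displaced by \<open>a\<close>; this is its
    inversion.\<close>
  have inv: "N * W $ (g + a) $ g = (\<Sum>b\<in>UNIV. chi (dot b g) * F a b)" for a g
  proof -
    have "(\<Sum>b\<in>UNIV. chi (dot b g) * F a b)
        = (\<Sum>b\<in>UNIV. \<Sum>g'\<in>UNIV. chi (dot b (g - g')) * W $ (g' + a) $ g')"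
    proof (rule sum.cong [OF refl])
      fix b
      have "chi (dot b (g - g')) = chi (dot b g) * chi (- dot b g')" for g'
        by (simp flip: chi_add)
      then show "chi (dot b g) * F a b = (\<Sum>g'\<in>UNIV. chi (dot b (g - g')) * W $ (g' + a) $ g')"
        by (simp add: F_def trace_dagger_weyl sum_distrib_left mult.assoc)
    qed
    also have "\<dots> = (\<Sum>g'\<in>UNIV. (\<Sum>b\<in>UNIV. chi (dot b (g - g'))) * W $ (g' + a) $ g')"
      by (subst sum.swap) (simp add: sum_distrib_right)
    also have "\<dots> = (\<Sum>g'\<in>UNIV. if g' = g then N * W $ (g' + a) $ g' else 0)"
      by (rule sum.cong) (auto simp only: sum_chi_dot N_def right_minus_eq split: if_splits, simp_all)
    finally show ?thesis by simp
  qed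
  have "W $ f $ g = cscale (F 0 0 / N) (mat 1) $ f $ g" for f g
  proof (cases "f = g")
    case True
    have "chi (dot b g) * F 0 b = (if b = 0 then F 0 0 else 0)" for b
      using assms [of 0 b] by (auto simp: F_def)
    then have "(\<Sum>b\<in>UNIV. chi (dot b g) * F 0 b) = F 0 0"
      by simp
    then show ?thesis
      using True inv [of g 0] \<open>N \<noteq> 0\<close> by (simp add: mat_def field_simps)
  next
    case False
    then have "F (f - g) b = 0" for b
      unfolding F_def by (intro assms) simp
    then show ?thesis
      using False inv [of g "f - g"] \<open>N \<noteq> 0\<close> by (simp add: mat_def)
  qed
  then show ?thesis
    by (intro that [of "F 0 0 / N"] matrix_eqI)
qed

section \<open>The Clifford hierarchy\<close>

lemma cmod_1_if_unitary:
  assumes "unitary (cscale c U)" "unitary U"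
  shows "cmod c = 1"
proof -
  have "cscale (cnj c * c) (mat 1 :: complex ^ 'a ^ 'a) = mat 1"
    using unitaryD(1) [OF assms(1)] assms(2) by (simp add: mult.commute)
  then have "cnj c * c = 1"
    by (simp add: cscale_eq_self_iff)
  then show ?thesis
    using complex_norm_square [of c] norm_ge_zero [of c]
    by (auto simp: mult.commute power2_eq_1_iff simp flip: of_real_power)
qed

text \<open>The condition on \<open>dot b a\<close> keeps all powers of the Weyl operator free of
  phases, so that its \<open>m\<close>-th power is the identity. Commuting \<open>W\<close> past
  that power forces \<open>c ^ CARD('m) = 1\<close>.\<close>

lemma phase_of_weyl_commutation:
  fixes W :: "('n::finite, 'm::nontriv) op"
  assumes W: "unitary W" and comm: "W ** weyl a b = cscale c (weyl a b ** W)"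
    and "dot b a = 0"
  obtains x where "c = chi (x :: 'm mod_ring)"
proof -
  have "W ** weyl (\<lambda>i. of_nat n * a i) (\<lambda>i. of_nat n * b i)
      = cscale (c ^ n) (weyl (\<lambda>i. of_nat n * a i) (\<lambda>i. of_nat n * b i) ** W)" for n
  proof (induction n)
    case 0
    then show ?case
      by (simp flip: zero_fun_def)
  next
    case (Suc n)
    have "dot b (\<lambda>i. of_nat n * a i) = of_nat n * dot b a"
      by (simp add: dot_def sum_distrib_left algebra_simps)
    then have eq: "weyl (\<lambda>i. of_nat (Suc n) * a i) (\<lambda>i. of_nat (Suc n) * b i)
        = weyl a b ** weyl (\<lambda>i. of_nat n * a i) (\<lambda>i. of_nat n * b i)"
      using \<open>dot b a = 0\<close> by (simp add: weyl_mult plus_fun_def algebra_simps)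
    show ?case
      unfolding eq by (simp add: comm Suc matrix_mul_assoc) (simp add: Suc flip: matrix_mul_assoc)
  qed
  from this [of "CARD('m)"] have "cscale (c ^ CARD('m)) W = W"
    by (simp flip: zero_fun_def)
  then have "c ^ CARD('m) = 1"
    using W by (simp add: cscale_eq_self_iff)
  then show ?thesis
    using that root_of_unity_eq_chi by metis
qed

text \<open>Level 0 consists of the phases, so that the recursive step of the hierarchy also describes
  the passage to level 1.\<close>

definition clifford0 :: "('n::finite, 'm::nontriv) op set \<Rightarrow> nat \<Rightarrow> ('n, 'm) op set" where
  "clifford0 P j = (if j = 0 then {cscale c (mat 1) | c. cmod c = 1} else clifford P j)"

text \<open>The phases against the generators are matched by some Weyl operator. Dividing it out
  leaves an operator that commutes with all generators, hence a scalar.\<close>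

lemma clifford0_phase_commutators_imp_pauli:
  fixes W :: "('n::finite, 'm::nontriv) op"
  assumes W: "unitary W" and comm: "\<And>p. p \<in> pauli_group withY \<Longrightarrow> gcomm W p \<in> clifford0 (pauli_group withY) 0"
  shows "W \<in> clifford (pauli_group withY) 1"
proof -
  have phase: "\<exists>x :: 'm mod_ring. W ** weyl a b = cscale (chi x) (weyl a b ** W)" if dot: "dot b a = 0" for a b
  proof -
    obtain c where "gcomm W (weyl a b) = cscale c (mat 1)"
      using comm [OF weyl_in_pauli_group] by (auto simp: clifford0_def)
    then have eq: "W ** weyl a b = cscale c (weyl a b ** W)"
      using W by (intro commutation_if_gcomm_scalar) auto
    obtain x :: "'m mod_ring" where "c = chi x"
      by (rule phase_of_weyl_commutation [OF W eq dot])
    then show ?thesis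
      using eq by auto
  qed
  have "\<forall>i. \<exists>x :: 'm mod_ring. W ** pauli_X i = cscale (chi x) (pauli_X i ** W)"
    and "\<forall>i. \<exists>x :: 'm mod_ring. W ** pauli_Z i = cscale (chi x) (pauli_Z i ** W)"
    unfolding pauli_X_eq_weyl pauli_Z_eq_weyl by (intro allI phase; simp)+
  then obtain x z :: "'n \<Rightarrow> 'm mod_ring" where x: "\<And>i. W ** pauli_X i = cscale (chi (x i)) (pauli_X i ** W)"
    and z: "\<And>i. W ** pauli_Z i = cscale (chi (z i)) (pauli_Z i ** W)"
    unfolding choice_iff by blast
  \<comment> \<open>Against \<open>pauli_X i\<close> the operator \<open>weyl a b\<close> picks up
    \<open>chi (b i)\<close>, against \<open>pauli_Z i\<close> it picks up
    \<open>chi (- a i)\<close>; hence the swapped arguments and the sign.\<close>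
  let ?w = "weyl (- z) x"
  have commute: "(dagger ?w ** W) ** p = p ** (dagger ?w ** W)"
    if p: "W ** p = cscale c (p ** W)" "?w ** p = cscale c (p ** ?w)" "cmod c = 1" for p c
  proof -
    have "dagger ?w ** (?w ** p) ** dagger ?w = dagger ?w ** cscale c (p ** ?w) ** dagger ?w"
      by (simp add: p(2))
    then have "p ** dagger ?w = cscale c (dagger ?w ** p)"
      by (simp flip: matrix_mul_assoc)
    then have "p ** (dagger ?w ** W) = cscale c (dagger ?w ** (p ** W))"
      by (simp add: matrix_mul_assoc)
    also have "\<dots> = dagger ?w ** (W ** p)"
      by (simp add: p(1))
    finally show ?thesis
      by (simp add: matrix_mul_assoc)
  qed
  have "acts_only_on {} (dagger ?w ** W)"
  proof (rule acts_only_onI)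
    show "(dagger ?w ** W) ** pauli_X i = pauli_X i ** (dagger ?w ** W)" for i
      by (rule commute [OF x])
        (simp_all add: pauli_X_eq_weyl weyl_commutation [of "- z" x "unit_fun i 1" 0])
    show "(dagger ?w ** W) ** pauli_Z i = pauli_Z i ** (dagger ?w ** W)" for i
      by (rule commute [OF z])
        (simp_all add: pauli_Z_eq_weyl weyl_commutation [of "- z" x 0 "unit_fun i 1"])
  qed
  then obtain c where "dagger ?w ** W = cscale c (mat 1)"
    by (rule acts_only_on_empty)
  then have "?w ** (dagger ?w ** W) = ?w ** cscale c (mat 1)"
    by simp
  then have W_eq: "W = cscale c ?w"
    by simp
  moreover have "cmod c = 1"
    using W unfolding W_eq by (rule cmod_1_if_unitary) simp
  ultimately show ?thesis
    using weyl_in_pauli_group [of "- z" x withY] by (auto simp: up_to_phase_def)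
qed

lemma clifford0_SucI:
  assumes "unitary W" "\<And>p. p \<in> pauli_group withY \<Longrightarrow> gcomm W p \<in> clifford0 (pauli_group withY) j"
  shows "W \<in> clifford0 (pauli_group withY) (Suc j)"
proof (cases j)
  case 0
  then show ?thesis
    using clifford0_phase_commutators_imp_pauli [of W withY] assms by (simp add: clifford0_def)
next
  case (Suc i)
  then show ?thesis
    using assms by (simp add: clifford0_def)
qed

text \<open>Handles commutators with scalar Paulis, to which no coset of nontrivial logical Paulis
  corresponds.\<close>

lemma mat_1_in_clifford0: "mat 1 \<in> clifford0 (pauli_group withY) j"
proof (induction j)
  case 0
  have "mat 1 = cscale 1 (mat 1)"
    by simp
  then show ?case
    unfolding clifford0_def by (auto intro!: exI [of _ 1])
next
  case (Suc j)
  then show ?case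
    by (intro clifford0_SucI) (simp_all add: pauli_group_is_pauli)
qed

section \<open>Logical operators in the encoded space\<close>

text \<open>Leaving the phase unspecified makes the exponents additive under products and gives all
  members of a coset of \<open>S\<close> the same exponents.\<close>

definition encodes ::
  "(('k::finite, 'm::nontriv) state, 'n::finite \<Rightarrow> 'm mod_ring) vec \<Rightarrow> ('n, 'm) op \<Rightarrow>
     ('k \<Rightarrow> 'm mod_ring) \<Rightarrow> ('k \<Rightarrow> 'm mod_ring) \<Rightarrow> bool"
where
  "encodes V A a b \<longleftrightarrow> (\<exists>c. cmod c = 1 \<and> A ** V = cscale c (V ** weyl a b))"

lemma encodes_mat_1 [simp]: "encodes V (mat 1) 0 0"
  unfolding encodes_def by (intro exI [of _ 1]) simp

lemma encodes_mult:
  assumes "encodes V A a b" "encodes V A' a' b'"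
  shows "encodes V (A ** A') (a + a') (b + b')"
proof -
  obtain c c' where c: "cmod c = 1" "A ** V = cscale c (V ** weyl a b)"
    "cmod c' = 1" "A' ** V = cscale c' (V ** weyl a' b')"
    using assms unfolding encodes_def by blast
  have "(A ** A') ** V = A ** (A' ** V)"
    by (simp flip: matrix_mul_assoc)
  also have "\<dots> = cscale c' (A ** V ** weyl a' b')"
    by (simp add: c(4) matrix_mul_assoc)
  also have "\<dots> = cscale (c' * c) (V ** (weyl a b ** weyl a' b'))"
    by (simp add: c(2) flip: matrix_mul_assoc)
  also have "\<dots> = cscale (c' * c * chi (dot b a')) (V ** weyl (a + a') (b + b'))"
    by (simp add: weyl_mult)
  finally show ?thesis
    unfolding encodes_def using c by (intro exI [of _ "c' * c * chi (dot b a')"]) (simp add: norm_mult)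
qed

lemma encodes_pow:
  assumes "encodes V A a b"
  shows "encodes V (A [^]\<^bsub>unitary_group\<^esub> n) (\<lambda>i. of_nat n * a i) (\<lambda>i. of_nat n * b i)"
proof (induction n)
  case 0
  have "encodes V (mat 1) 0 0"
    by simp
  then show ?case
    by (simp add: zero_fun_def)
next
  case (Suc n)
  have "(\<lambda>i. of_nat n * a i) + a = (\<lambda>i. of_nat (Suc n) * a i)" for a :: "'a \<Rightarrow> 'b mod_ring"
    by (simp add: plus_fun_def algebra_simps)
  with encodes_mult [OF Suc assms] show ?case
    by simp
qed

lemma encodes_comm_prod:
  assumes "finite I"
    and "\<And>x y. x \<in> I \<Longrightarrow> y \<in> I \<Longrightarrow> x \<noteq> y \<Longrightarrow> W x ** W y = W y ** W x"
    and "\<And>x. x \<in> I \<Longrightarrow> encodes V (W x) (a x) (b x)"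
  shows "encodes V (comm_prod W I) (\<Sum>x\<in>I. a x) (\<Sum>x\<in>I. b x)"
  using assms
proof (induction I)
  case (insert i I)
  have "comm_prod W (insert i I) = W i ** comm_prod W I"
    by (rule comm_prod_insert) (use insert in auto)
  moreover have "encodes V (W i ** comm_prod W I) (a i + sum a I) (b i + sum b I)"
    using insert by (intro encodes_mult) auto
  moreover have "sum a (insert i I) = a i + sum a I" "sum b (insert i I) = b i + sum b I"
    using insert.hyps by (rule sum.insert)+
  ultimately show ?case
    by (simp only:)
qed simp

section \<open>Transfer of commutators through the encoding\<close>

lemma intertwining_dagger:
  assumes "U ** V = V ** W" "unitary U" "unitary W"
  shows "dagger U ** V = V ** dagger W"
proof -
  have "dagger U ** V = dagger U ** (V ** W) ** dagger W"
    using assms(3) by (simp flip: matrix_mul_assoc)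
  also have "\<dots> = V ** dagger W"
    using assms(2) by (simp flip: assms(1))
  finally show ?thesis .
qed

lemma intertwining_mult:
  assumes "U ** V = V ** W" "U' ** V = V ** W'"
  shows "(U ** U') ** V = V ** (W ** W')"
proof -
  have "(U ** U') ** V = U ** V ** W'"
    by (simp add: assms(2) flip: matrix_mul_assoc)
  then show ?thesis
    by (simp add: assms(1) flip: matrix_mul_assoc)
qed

text \<open>A physical commutator with any representative \<open>g\<close> encodes the same logical
  commutator, since the phase of \<open>g\<close> drops out.\<close>

lemma intertwining_gcomm:
  assumes "U ** V = V ** W" "unitary U" "unitary W" and g: "encodes V g a b" "unitary g"
  shows "gcomm U g ** V = V ** gcomm W (weyl a b)"
proof -
  obtain c where c: "cmod c = 1" "g ** V = cscale c (V ** weyl a b)"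
    using g(1) unfolding encodes_def by blast
  let ?w = "cscale c (weyl a b)"
  have gV: "g ** V = V ** ?w"
    using c(2) by simp
  have "gcomm U g ** V = V ** gcomm W ?w"
    unfolding gcomm_def
    by (intro intertwining_mult intertwining_dagger assms(1-3) gV g(2)) (simp add: c(1))
  then show ?thesis
    by (simp add: gcomm_cscale c(1))
qed

lemma unitary_group_pow_commute:
  "A ** B = B ** A \<Longrightarrow> (A [^]\<^bsub>unitary_group\<^esub> (n::nat)) ** B = B ** (A [^]\<^bsub>unitary_group\<^esub> n)"
  by (induction n) (simp_all add: commute_mult)

lemma unitary_group_pow_commute_both:
  assumes "A ** B = B ** A"
  shows "(A [^]\<^bsub>unitary_group\<^esub> (n::nat)) ** (B [^]\<^bsub>unitary_group\<^esub> (k::nat))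
    = (B [^]\<^bsub>unitary_group\<^esub> k) ** (A [^]\<^bsub>unitary_group\<^esub> n)"
  by (rule unitary_group_pow_commute, rule unitary_group_pow_commute [symmetric]) (simp add: assms)

lemma sum_mult_matrix: "(\<Sum>s\<in>S. f s) ** B = (\<Sum>s\<in>S. f s ** (B :: complex ^ 'a ^ 'b))"
  by (rule matrix_eqI) (simp add: mat_mult_nth sum_distrib_right sum.swap [of _ _ UNIV])

lemma mult_sum_matrix: "B ** (\<Sum>s\<in>S. f s) = (\<Sum>s\<in>S. (B :: complex ^ 'a ^ 'b) ** f s)"
  by (rule matrix_eqI) (simp add: mat_mult_nth sum_distrib_left sum.swap [of _ _ UNIV])

lemma sum_const_matrix: "(\<Sum>s\<in>S. A) = cscale (of_nat (card S)) A"
  by (rule matrix_eqI) (simp add: sum_component del: sum_constant, simp)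

lemma dagger_sum: "dagger (\<Sum>s\<in>S. f s) = (\<Sum>s\<in>S. dagger (f s))"
  by (rule matrix_eqI) (simp add: cnj_sum)

lemma trace_sum: "trace (\<Sum>s\<in>S. f s) = (\<Sum>s\<in>S. trace (f s))"
  by (simp add: trace_def) (rule sum.swap)

text \<open>One commutator costs a cone exponent \<open>h\<close> and leaves \<open>j\<close>
  commutators of a circuit of depth \<open>2 * h\<close>.\<close>

lemma depth_recursion: "(2 ^ Suc j - 1) * h = h + (2 ^ j - 1) * (2 * h)" for h :: nat
proof -
  obtain n where "(2::nat) ^ j = Suc n"
    by (metis gr0_conv_Suc zero_less_numeral zero_less_power)
  then show ?thesis
    by (simp add: algebra_simps)
qed

section \<open>A stabilizer code with its logical Paulis\<close>

locale logical_code =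
  fixes withY :: bool
    and S :: "('n::finite, 'm::nontriv) op set"
    and Xbar Zbar :: "'k::finite \<Rightarrow> ('n, 'm) op"
  assumes code: "stabilizer_code withY CARD('k) S"
    and gens: "logical_pauli_generators withY S Xbar Zbar"
begin

abbreviation "L \<equiv> nontrivial_logical_paulis S Xbar Zbar"

lemma S_pauli: "s \<in> S \<Longrightarrow> is_pauli s"
  using code unfolding stabilizer_code_def
  by (auto elim!: generate_is_pauli intro: pauli_group_is_pauli)

lemma S_subgroup: "subgroup S unitary_group"
proof -
  obtain s where s: "\<forall>i<CARD('n) - CARD('k). s i \<in> pauli_group withY"
    "S = generate unitary_group (s ` {..<CARD('n) - CARD('k)})"
    using code unfolding stabilizer_code_def by blast
  show ?thesis
    unfolding s(2) using s(1)
    by (intro unitary_group.generate_is_subgroup) (auto intro: is_pauli_unitary pauli_group_is_pauli)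
qed

lemma S_mult: "s \<in> S \<Longrightarrow> t \<in> S \<Longrightarrow> s ** t \<in> S"
  using subgroup.m_closed [OF S_subgroup] by simp

lemma S_dagger: "s \<in> S \<Longrightarrow> dagger s \<in> S"
  using subgroup.m_inv_closed [OF S_subgroup, of s] by (simp add: S_pauli)

text \<open>The prescribed cardinality is positive, which excludes the infinite as well as the empty
  case.\<close>

lemma finite_S: "finite S" and S_nonempty: "S \<noteq> {}"
  using code card_gt_0_iff [of S] unfolding stabilizer_code_def by auto

lemma gens_pauli [simp]: "is_pauli (Xbar i)" "is_pauli (Zbar i)"
  using gens by (auto simp: logical_pauli_generators_def intro: pauli_group_is_pauli)

lemma gens_commute_S: "s \<in> S \<Longrightarrow> Xbar i ** s = s ** Xbar i" "s \<in> S \<Longrightarrow> Zbar i ** s = s ** Zbar i"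
  using gens by (auto simp: logical_pauli_generators_def)

lemma gens_commute:
  "Xbar i ** Xbar j = Xbar j ** Xbar i" "Zbar i ** Zbar j = Zbar j ** Zbar i"
  "i \<noteq> j \<Longrightarrow> Xbar i ** Zbar j = Zbar j ** Xbar i"
proof -
  have "gcomm (Xbar i) (Xbar j) = mat 1" "gcomm (Zbar i) (Zbar j) = mat 1"
    "i \<noteq> j \<Longrightarrow> gcomm (Xbar i) (Zbar j) = mat 1"
    using gens by (auto simp: logical_pauli_generators_def)
  then show "Xbar i ** Xbar j = Xbar j ** Xbar i" "Zbar i ** Zbar j = Zbar j ** Zbar i"
    "i \<noteq> j \<Longrightarrow> Xbar i ** Zbar j = Zbar j ** Xbar i"
    by (simp_all add: gcomm_eq_1_iff)
qed

text \<open>Makes \<open>comm_prod\<close> meaningful for logical Paulis: factors of different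
  logical qudits commute, although \<open>Xbar i\<close> and \<open>Zbar i\<close> do not.\<close>

lemma logical_pauli_factor_commute:
  assumes "i \<noteq> j"
  shows "(Xbar i [^]\<^bsub>unitary_group\<^esub> (a i :: nat) ** Zbar i [^]\<^bsub>unitary_group\<^esub> (b i :: nat)) **
      (Xbar j [^]\<^bsub>unitary_group\<^esub> a j ** Zbar j [^]\<^bsub>unitary_group\<^esub> b j)
    = (Xbar j [^]\<^bsub>unitary_group\<^esub> a j ** Zbar j [^]\<^bsub>unitary_group\<^esub> b j) **
      (Xbar i [^]\<^bsub>unitary_group\<^esub> a i ** Zbar i [^]\<^bsub>unitary_group\<^esub> b i)"
  using assms
  by (intro commute_mult commute_mult [symmetric] unitary_group_pow_commute_both gens_commute
      gens_commute [symmetric]) auto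

lemma logical_pauli_pauli: "is_pauli (logical_pauli Xbar Zbar a b)"
  unfolding logical_pauli_def
  by (rule is_pauli_comm_prod) (simp_all add: logical_pauli_factor_commute)

lemma finite_L: "finite L"
proof -
  let ?A = "{f :: 'k \<Rightarrow> nat. \<forall>i. f i < CARD('m)}"
  have "?A = (UNIV :: 'k set) \<rightarrow>\<^sub>E {..<CARD('m)}"
    by auto
  then have "finite ?A"
    by (simp add: finite_PiE)
  moreover have "L \<subseteq> (\<lambda>(a, b). (\<lambda>s. s ** logical_pauli Xbar Zbar a b) ` S) ` (?A \<times> ?A)"
    unfolding nontrivial_logical_paulis_def by fastforce
  ultimately show ?thesis
    by (meson finite_SigmaI finite_imageI finite_subset)
qed

lemma L_cosets:
  assumes "G \<in> L"
  shows "finite G" "G \<noteq> {}" "g \<in> G \<Longrightarrow> is_pauli g"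
  using assms finite_S S_nonempty S_pauli logical_pauli_pauli
  by (auto simp: nontrivial_logical_paulis_def)

lemma L_nonempty: "L \<noteq> {}"
proof -
  have "1 < CARD('m)"
    by (rule nontriv)
  then have "(\<lambda>s. s ** logical_pauli Xbar Zbar (\<lambda>_. 1) (\<lambda>_. 1)) ` S \<in> L"
    unfolding nontrivial_logical_paulis_def by force
  then show ?thesis by auto
qed

section \<open>Consequences of a fixed identification of the code space\<close>

context
  fixes V :: "(('k, 'm) state, 'n \<Rightarrow> 'm mod_ring) vec"
  assumes V: "logical_identification S Xbar Zbar V"
begin

lemma V_isometry [simp]: "dagger V ** V = mat 1"
  using V by (simp add: logical_identification_def)

lemma V_isometry_assoc [simp]: "dagger V ** (V ** A) = A"
  by (simp add: matrix_mul_assoc)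

lemma range_V: "range ((*v) V) = code_space S"
  using V by (simp add: logical_identification_def)

text \<open>\<open>V ** dagger V\<close> fixes the range of \<open>V\<close>, which is the code
  space.\<close>

lemma V_projection:
  assumes "\<And>x. A *v x \<in> code_space S"
  shows "V ** (dagger V ** A) = A"
proof (subst matrix_eq, rule allI)
  fix x
  obtain y where y: "A *v x = V *v y"
    using assms range_V by blast
  have "(V ** (dagger V ** A)) *v x = V *v (dagger V *v (A *v x))"
    by (simp flip: matrix_vector_mul_assoc)
  also have "\<dots> = (V ** (dagger V ** V)) *v y"
    by (simp only: y matrix_vector_mul_assoc)
  finally show "(V ** (dagger V ** A)) *v x = A *v x"
    by (simp add: y)
qed

lemma S_fixes_V: "s \<in> S \<Longrightarrow> s ** V = V"
proof (subst matrix_eq, rule allI)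
  fix x assume "s \<in> S"
  have "V *v x \<in> code_space S"
    using range_V by blast
  then show "(s ** V) *v x = V *v x"
    using \<open>s \<in> S\<close> by (simp add: code_space_def flip: matrix_vector_mul_assoc)
qed

text \<open>Averaging over the stabilizer group gives the code projector. Invariance of the sum puts
  its range into the code space, so \<open>V ** dagger V\<close> can be inserted; as the sum is
  self-adjoint, it can be inserted on the right too, where each \<open>s\<close> fixes
  \<open>V\<close>.\<close>

lemma sum_S_eq: "(\<Sum>s\<in>S. s) = cscale (of_nat (card S)) (V ** dagger V)"
proof -
  let ?T = "\<Sum>s\<in>S. s"
  have dT: "dagger ?T = ?T"
    unfolding dagger_sum
    by (rule sum.reindex_bij_witness [of _ dagger dagger]) (auto simp: S_dagger)
  have "s ** ?T = ?T" if "s \<in> S" for s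
    unfolding mult_sum_matrix
    by (rule sum.reindex_bij_witness [of _ "\<lambda>t. dagger s ** t" "\<lambda>t. s ** t"])
      (use that in \<open>auto simp: S_mult S_dagger S_pauli\<close>)
  then have "?T *v x \<in> code_space S" for x
    by (simp add: code_space_def matrix_vector_mul_assoc)
  then have "V ** (dagger V ** ?T) = ?T"
    by (rule V_projection)
  from arg_cong [OF this, of dagger] have "?T ** V ** dagger V = ?T"
    by (simp add: dagger_mult dT)
  moreover have "?T ** V = cscale (of_nat (card S)) V"
    by (simp add: sum_mult_matrix S_fixes_V sum_const_matrix del: sum_constant)
  ultimately show ?thesis
    by simp
qed

lemma logical_pauli_encodes:
  "encodes V (logical_pauli Xbar Zbar a b) (\<lambda>i. of_nat (a i)) (\<lambda>i. of_nat (b i))"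
proof -
  have X: "encodes V (Xbar i) (unit_fun i 1) 0" and Z: "encodes V (Zbar i) 0 (unit_fun i 1)" for i
    using V unfolding logical_identification_def encodes_def pauli_X_eq_weyl pauli_Z_eq_weyl
    by simp_all
  have unit: "(\<lambda>j. of_nat n * unit_fun i 1 j) = unit_fun i (of_nat n)"
    "(\<lambda>j :: 'k. of_nat n * 0 j) = (0 :: 'k \<Rightarrow> 'm mod_ring)" for i :: 'k and n
    by (auto simp: unit_fun_def fun_eq_iff)
  have factor: "encodes V (Xbar i [^]\<^bsub>unitary_group\<^esub> a i ** Zbar i [^]\<^bsub>unitary_group\<^esub> b i)
      (unit_fun i (of_nat (a i))) (unit_fun i (of_nat (b i)))" for i
    using encodes_mult [OF encodes_pow [OF X [of i], of "a i"] encodes_pow [OF Z [of i], of "b i"]]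
    unfolding unit by simp
  have total: "(\<Sum>i\<in>UNIV. unit_fun i (x i)) = x" for x :: "'k \<Rightarrow> 'm mod_ring"
  proof
    have "(\<Sum>i\<in>F. unit_fun i (x i)) j = (\<Sum>i\<in>F. unit_fun i (x i) j)" for F j
      by (induction F rule: infinite_finite_induct) simp_all
    then show "(\<Sum>i\<in>UNIV. unit_fun i (x i)) j = x j" for j
      by (simp add: unit_fun_def)
  qed
  have "encodes V (logical_pauli Xbar Zbar a b)
      (\<Sum>i\<in>UNIV. unit_fun i (of_nat (a i))) (\<Sum>i\<in>UNIV. unit_fun i (of_nat (b i)))"
    unfolding logical_pauli_def
    by (rule encodes_comm_prod) (simp_all add: factor logical_pauli_factor_commute)
  then show ?thesis
    unfolding total .
qed

lemma coset_encodes: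
  assumes "s \<in> S"
  shows "encodes V (s ** logical_pauli Xbar Zbar a b) (\<lambda>i. of_nat (a i)) (\<lambda>i. of_nat (b i))"
proof -
  have "encodes V s 0 0"
    unfolding encodes_def by (intro exI [of _ 1]) (simp add: S_fixes_V [OF assms])
  from encodes_mult [OF this logical_pauli_encodes] show ?thesis
    by simp
qed

lemma nontrivial_coset:
  assumes "\<alpha> \<noteq> 0 \<or> \<beta> \<noteq> 0"
  obtains l where "(\<lambda>s. s ** l) ` S \<in> L" "encodes V l \<alpha> \<beta>" "is_pauli l"
    "\<forall>g\<in>(\<lambda>s. s ** l) ` S. encodes V g \<alpha> \<beta>"
proof -
  \<comment> \<open>Least nonnegative residues lie in the exponent range that the definition of the
    cosets demands.\<close>
  define a b where "a = (\<lambda>i. nat (to_int_mod_ring (\<alpha> i)))" and "b = (\<lambda>i. nat (to_int_mod_ring (\<beta> i)))"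
  have ab: "(\<lambda>i. of_nat (a i)) = \<alpha>" "(\<lambda>i. of_nat (b i)) = \<beta>"
    by (simp_all add: a_def b_def)
  have "\<forall>i. a i < CARD('m) \<and> b i < CARD('m)"
    using to_int_mod_ring_bounds [where 'm = 'm] by (simp add: a_def b_def nat_less_iff)
  moreover have "\<not> (\<forall>i. a i = 0 \<and> b i = 0)"
  proof
    assume "\<forall>i. a i = 0 \<and> b i = 0"
    then have "\<alpha> i = 0 \<and> \<beta> i = 0" for i
      using fun_cong [OF ab(1), of i] fun_cong [OF ab(2), of i] by simp
    with assms show False
      by (simp add: fun_eq_iff)
  qed
  ultimately have "(\<lambda>s. s ** logical_pauli Xbar Zbar a b) ` S \<in> L"
    unfolding nontrivial_logical_paulis_def by blast
  then show ?thesis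
    using that [of "logical_pauli Xbar Zbar a b"] logical_pauli_encodes [of a b] coset_encodes [of _ a b]
    by (auto simp: ab logical_pauli_pauli)
qed

text \<open>The coset sum \<open>\<Sum>s. (s l)\<^sup>\<dagger>\<close> is a multiple of \<open>l\<^sup>\<dagger> V V\<^sup>\<dagger>\<close>, so the trace of the encoded operator
  against a nontrivial Weyl operator is a combination of traces against elements of a
  nontrivial coset. Each of these vanishes because no such element is supported inside \<open>supp U\<close>.\<close>

lemma small_support_imp_phase:
  assumes U: "unitary U" and W: "unitary W" and UV: "U ** V = V ** W"
    and small: "card (supp Q U) < min_distance Q L"
  shows "W \<in> clifford0 P 0"
proof -
  have "trace (dagger (weyl \<alpha> \<beta>) ** W) = 0" if nz: "\<alpha> \<noteq> 0 \<or> \<beta> \<noteq> 0" for \<alpha> \<beta>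
  proof -
    obtain l where l: "(\<lambda>s. s ** l) ` S \<in> L" "encodes V l \<alpha> \<beta>" "is_pauli l"
      using nontrivial_coset [OF nz] by metis
    obtain c where c: "cmod c = 1" "l ** V = cscale c (V ** weyl \<alpha> \<beta>)"
      using l(2) unfolding encodes_def by blast
    have "trace (dagger (s ** l) ** U) = 0" if "s \<in> S" for s
    proof (rule trace_dagger_pauli_zero)
      show "is_pauli (s ** l)"
        using that l(3) by (simp add: S_pauli)
      have "min_distance Q L \<le> card (supp Q (s ** l))"
        using that l(1) finite_L L_cosets(1) by (intro min_distance_le) auto
      then show "\<not> supp Q (s ** l) \<subseteq> supp Q U"
        using small card_mono [of "supp Q U" "supp Q (s ** l)"] by auto
    qed
    then have "0 = trace (\<Sum>s\<in>S. dagger (s ** l) ** U)"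
      by (simp add: trace_sum)
    also have "(\<Sum>s\<in>S. dagger (s ** l) ** U) = dagger l ** dagger (\<Sum>s\<in>S. s) ** U"
      by (simp add: dagger_mult dagger_sum mult_sum_matrix sum_mult_matrix)
    also have "\<dots> = cscale (of_nat (card S)) (dagger l ** V ** (dagger V ** U))"
      by (simp add: sum_S_eq dagger_mult matrix_mul_assoc)
    \<comment> \<open>Being unitary, \<open>U\<close> preserves the orthogonal complement of the
      code space as well, so it can be moved through from this side.\<close>
    also have "dagger V ** U = W ** dagger V"
      using arg_cong [OF intertwining_dagger [OF UV U W], of dagger] by (simp add: dagger_mult)
    also have "dagger l ** V = V ** cscale (cnj c) (dagger (weyl \<alpha> \<beta>))"
      using intertwining_dagger [of l V "cscale c (weyl \<alpha> \<beta>)"] c l(3) by simp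
    finally have "trace (V ** (dagger (weyl \<alpha> \<beta>) ** (W ** dagger V))) = 0"
      using c(1) finite_S S_nonempty by (auto simp flip: matrix_mul_assoc)
    then have "trace (dagger (weyl \<alpha> \<beta>) ** (W ** dagger V) ** V) = 0"
      using trace_mul_sym [of V "dagger (weyl \<alpha> \<beta>) ** (W ** dagger V)"] by argo
    then show ?thesis
      by (simp flip: matrix_mul_assoc)
  qed
  then obtain c where c: "W = cscale c (mat 1)"
    using scalar_if_trace_zero by blast
  moreover have "cmod c = 1"
    using W unfolding c by (rule cmod_1_if_unitary) simp
  ultimately show ?thesis
    by (auto simp: clifford0_def)
qed

text \<open>Reduces the hierarchy condition to cosets, which leaves the representative
  \<open>g\<close> free to be chosen by its support. The phase of a Pauli drops out of the
  commutator, and scalar Paulis give the identity.\<close>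

lemma clifford0_Suc_if_coset_commutators:
  assumes W: "unitary W"
    and step: "\<And>G \<alpha> \<beta>. G \<in> L \<Longrightarrow> (\<And>g. g \<in> G \<Longrightarrow> encodes V g \<alpha> \<beta>) \<Longrightarrow>
      gcomm W (weyl \<alpha> \<beta>) \<in> clifford0 (pauli_group withY) j"
  shows "W \<in> clifford0 (pauli_group withY) (Suc j)"
proof (rule clifford0_SucI [OF W])
  fix p :: "('k, 'm) op" assume "p \<in> pauli_group withY"
  then obtain c \<alpha> \<beta> where p: "cmod c = 1" "p = cscale c (weyl \<alpha> \<beta>)"
    using pauli_group_is_pauli is_pauliE by metis
  then have eq: "gcomm W p = gcomm W (weyl \<alpha> \<beta>)"
    by (simp add: gcomm_cscale)
  show "gcomm W p \<in> clifford0 (pauli_group withY) j"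
  proof (cases "\<alpha> = 0 \<and> \<beta> = 0")
    case True
    then show ?thesis
      using W mat_1_in_clifford0 by (simp add: eq)
  next
    case False
    then have "\<alpha> \<noteq> 0 \<or> \<beta> \<noteq> 0"
      by simp
    then obtain l where l: "(\<lambda>s. s ** l) ` S \<in> L" "encodes V l \<alpha> \<beta>" "is_pauli l"
      "\<forall>g\<in>(\<lambda>s. s ** l) ` S. encodes V g \<alpha> \<beta>"
      by (rule nontrivial_coset)
    show ?thesis
      unfolding eq using l(4) by (intro step [OF l(1)]) blast
  qed
qed

text \<open>The bound is an invariant: a commutator multiplies the support by at most
  \<open>q ^ h\<close> over the disjointness, doubles \<open>h\<close> and lowers \<open>j\<close>.
  Hence the induction generalises over the depth as well as over the operators.\<close>

lemma local_circuit_clifford0: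
  assumes Q: "partition_on UNIV Q"
    and "unitary W" "U ** V = V ** W" "local_circuit Q q h U"
    and "real (card (supp Q U)) * real q ^ ((2 ^ j - 1) * h) < real (min_distance Q L) * disjointness Q L ^ j"
  shows "W \<in> clifford0 (pauli_group withY) j"
  using assms(2-)
proof (induction j arbitrary: U W h)
  case 0
  then show ?case
    using local_circuit_unitary by (intro small_support_imp_phase [of U]) auto
next
  case (Suc j)
  note U = local_circuit_unitary [OF Suc.prems(3)]
  show ?case
  proof (rule clifford0_Suc_if_coset_commutators [OF Suc.prems(1)])
    fix G \<alpha> \<beta>
    assume G: "G \<in> L" and enc: "\<And>g. g \<in> G \<Longrightarrow> encodes V g \<alpha> \<beta>"
    have "supp Q U \<subseteq> Q"
      by (auto simp: supp_def)
    then obtain g where g: "g \<in> G"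
      "real (card (supp Q U \<inter> supp Q g)) * disjointness Q L \<le> real (card (supp Q U))"
      using scrubbing [OF finite_L G L_cosets(1) L_cosets(2) [OF G], of "supp Q U" Q] by auto
    have p: "is_pauli g"
      using L_cosets(3) [OF G g(1)] .
    have D: "0 \<le> disjointness Q L"
      using disjointness_nonneg [OF finite_L L_nonempty L_cosets(1)] .
    let ?U = "gcomm U g"
    have "card (supp Q ?U) \<le> q ^ h * card (supp Q U \<inter> supp Q g)"
      using card_supp_gcomm_le [OF Q U local_circuit_spreads [OF Q Suc.prems(3)] p] .
    then have "real (card (supp Q ?U)) \<le> real q ^ h * real (card (supp Q U \<inter> supp Q g))"
      by (metis of_nat_le_iff of_nat_mult of_nat_power)
    then have "real (card (supp Q ?U)) * disjointness Q L
        \<le> real q ^ h * real (card (supp Q U \<inter> supp Q g)) * disjointness Q L"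
      using D by (rule mult_right_mono)
    also have "\<dots> \<le> real q ^ h * real (card (supp Q U))"
      using g(2) by (simp add: mult.assoc mult_left_mono)
    finally have le: "real (card (supp Q ?U)) * disjointness Q L \<le> real q ^ h * real (card (supp Q U))" .
    have "(2 ^ Suc j - 1) * h = h + (2 ^ j - 1) * (2 * h)"
      by (rule depth_recursion)
    then have exp: "real q ^ ((2 ^ Suc j - 1) * h) = real q ^ h * real q ^ ((2 ^ j - 1) * (2 * h))"
      by (simp only: power_add)
    have "(real (card (supp Q ?U)) * real q ^ ((2 ^ j - 1) * (2 * h))) * disjointness Q L
        \<le> (real q ^ h * real (card (supp Q U))) * real q ^ ((2 ^ j - 1) * (2 * h))"
      using mult_right_mono [OF le, of "real q ^ ((2 ^ j - 1) * (2 * h))"] by (simp add: mult_ac)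
    also have "\<dots> < (real (min_distance Q L) * disjointness Q L ^ j) * disjointness Q L"
      using Suc.prems(4) unfolding exp by (simp add: mult_ac)
    finally have bound: "real (card (supp Q ?U)) * real q ^ ((2 ^ j - 1) * (2 * h))
        < real (min_distance Q L) * disjointness Q L ^ j"
      using D by (rule mult_right_less_imp_less)
    show "gcomm W (weyl \<alpha> \<beta>) \<in> clifford0 (pauli_group withY) j"
    proof (rule Suc.IH [OF _ _ _ bound])
      show "unitary (gcomm W (weyl \<alpha> \<beta>))"
        using Suc.prems(1) by simp
      show "gcomm U g ** V = V ** gcomm W (weyl \<alpha> \<beta>)"
        using intertwining_gcomm [OF Suc.prems(2) U Suc.prems(1) enc [OF g(1)]] p by simp
      show "local_circuit Q q (2 * h) (gcomm U g)"
        using local_circuit_gcomm [OF Suc.prems(3) p] .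
    qed
  qed
qed

text \<open>Preservation of the code space lets \<open>V ** dagger V\<close> be inserted after
  \<open>U ** V\<close>; this supplies the starting point of the chain of commutators.\<close>

lemma logical_operator_intertwines:
  assumes "logical_operator S U"
  shows "U ** V = V ** (dagger V ** U ** V)" "unitary (dagger V ** U ** V)"
proof -
  have U: "unitary U"
    using assms by (simp add: logical_operator_def)
  have "(U ** V) *v x \<in> code_space S" for x
    using assms range_V by (auto simp: logical_operator_def simp flip: matrix_vector_mul_assoc)
  then have "V ** (dagger V ** (U ** V)) = U ** V"
    by (rule V_projection)
  then show UV: "U ** V = V ** (dagger V ** U ** V)"
    by (simp add: matrix_mul_assoc)
  have "dagger (dagger V ** U ** V) ** (dagger V ** U ** V) = dagger V ** dagger U ** (V ** (dagger V ** U ** V))"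
    by (simp add: dagger_mult matrix_mul_assoc)
  also have "\<dots> = mat 1"
    unfolding UV [symmetric] using U by (simp flip: matrix_mul_assoc)
  finally show "unitary (dagger V ** U ** V)"
    by (rule unitaryI)
qed

text \<open>The first commutator stays outside the induction because \<open>supp U\<close> has no
  useful bound yet. A shortest coset representative supplies one, which is why the disjointness
  occurs only to the power \<open>M - 1\<close>.\<close>

lemma local_circuit_clifford:
  assumes Q: "partition_on UNIV Q" and "M \<ge> 1"
    and bound: "real (max_distance Q L) * real q ^ ((2 ^ M - 1) * h)
      < real (min_distance Q L) * disjointness Q L ^ (M - 1)"
    and logical: "logical_operator S U" and circuit: "local_circuit Q q h U"
  shows "dagger V ** U ** V \<in> clifford (pauli_group withY) M"
proof -
  obtain j where M: "M = Suc j"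
    using \<open>M \<ge> 1\<close> by (cases M) auto
  let ?W = "dagger V ** U ** V"
  note W = logical_operator_intertwines [OF logical]
  note U = local_circuit_unitary [OF circuit]
  have "?W \<in> clifford0 (pauli_group withY) (Suc j)"
  proof (rule clifford0_Suc_if_coset_commutators [OF W(2)])
    fix G \<alpha> \<beta>
    assume G: "G \<in> L" and enc: "\<And>g. g \<in> G \<Longrightarrow> encodes V g \<alpha> \<beta>"
    obtain g where g: "g \<in> G" "card (supp Q g) = dist_coset Q G"
      using dist_coset_attained L_cosets [OF G] by metis
    have p: "is_pauli g"
      using L_cosets(3) [OF G g(1)] .
    have "card (supp Q (gcomm U g)) \<le> q ^ h * card (supp Q U \<inter> supp Q g)"
      using card_supp_gcomm_le [OF Q U local_circuit_spreads [OF Q circuit] p] .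
    also have "card (supp Q U \<inter> supp Q g) \<le> card (supp Q g)"
      by (intro card_mono) auto
    also have "\<dots> \<le> max_distance Q L"
      unfolding g(2) by (rule max_distance_ge [OF finite_L G])
    finally have "card (supp Q (gcomm U g)) \<le> q ^ h * max_distance Q L"
      by simp
    then have le: "real (card (supp Q (gcomm U g))) \<le> real q ^ h * real (max_distance Q L)"
      by (metis of_nat_le_iff of_nat_mult of_nat_power)
    have "(2 ^ M - 1) * h = h + (2 ^ j - 1) * (2 * h)"
      unfolding M by (rule depth_recursion)
    then have exp: "real q ^ ((2 ^ M - 1) * h) = real q ^ h * real q ^ ((2 ^ j - 1) * (2 * h))"
      by (simp only: power_add)
    have "real (card (supp Q (gcomm U g))) * real q ^ ((2 ^ j - 1) * (2 * h))
        \<le> real (max_distance Q L) * real q ^ ((2 ^ M - 1) * h)"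
      unfolding exp using mult_right_mono [OF le, of "real q ^ ((2 ^ j - 1) * (2 * h))"]
      by (simp add: mult_ac)
    also note bound
    finally have bound': "real (card (supp Q (gcomm U g))) * real q ^ ((2 ^ j - 1) * (2 * h))
        < real (min_distance Q L) * disjointness Q L ^ j"
      by (simp add: M)
    show "gcomm ?W (weyl \<alpha> \<beta>) \<in> clifford0 (pauli_group withY) j"
    proof (rule local_circuit_clifford0 [OF Q _ _ _ bound'])
      show "unitary (gcomm ?W (weyl \<alpha> \<beta>))"
        using W(2) by simp
      show "gcomm U g ** V = V ** gcomm ?W (weyl \<alpha> \<beta>)"
        using intertwining_gcomm [OF W(1) U W(2) enc [OF g(1)]] p by simp
      show "local_circuit Q q (2 * h) (gcomm U g)"
        using local_circuit_gcomm [OF circuit p] .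
    qed
  qed
  then show ?thesis
    by (simp add: clifford0_def M)
qed

end

end

section \<open>Existence of an identification\<close>

text \<open>The shift by 1 also works for composite \<open>m\<close>, where a nonzero
  \<open>t\<close> may fail to be invertible.\<close>

lemma sum_chi: "(\<Sum>y\<in>UNIV. chi (y * t)) = (if t = 0 then of_nat CARD('m) else 0)"
  for t :: "'m::nontriv mod_ring"
proof (cases "t = 0")
  case False
  have "(\<Sum>y\<in>UNIV. chi (y * t)) = (\<Sum>y\<in>UNIV. chi (y * t + t))"
    by (rule sum.reindex_bij_witness [of _ "\<lambda>y. y + 1" "\<lambda>y. y - 1"]) (auto simp: distrib_right left_diff_distrib)
  also have "\<dots> = chi t * (\<Sum>y\<in>UNIV. chi (y * t))"
    by (simp add: chi_add sum_distrib_left mult.commute)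
  finally show ?thesis
    using False by (metis chi_eq_1_iff mult_cancel_right1)
qed simp

section \<open>Powers with exponents modulo \<open>m\<close>\<close>

lemma unitary_pow [simp]: "unitary A \<Longrightarrow> unitary (A [^]\<^bsub>unitary_group\<^esub> (n::nat))"
  by (induction n) auto

lemma cscale_pow: "(cscale c A) [^]\<^bsub>unitary_group\<^esub> (n::nat) = cscale (c ^ n) (A [^]\<^bsub>unitary_group\<^esub> n)"
  by (induction n) (auto simp: mult.commute)

definition mod_pow :: "complex ^ 'a ^ 'a \<Rightarrow> 'm::nontriv mod_ring \<Rightarrow> complex ^ 'a ^ 'a" where
  "mod_pow A t = A [^]\<^bsub>unitary_group\<^esub> nat (to_int_mod_ring t)"

lemma mod_pow_of_nat:
  assumes A: "unitary A" and order: "A [^]\<^bsub>unitary_group\<^esub> CARD('m) = mat 1"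
  shows "mod_pow A (of_nat n :: 'm::nontriv mod_ring) = A [^]\<^bsub>unitary_group\<^esub> n"
proof -
  have "(A [^]\<^bsub>unitary_group\<^esub> CARD('m)) [^]\<^bsub>unitary_group\<^esub> (n div CARD('m)) = mat 1"
    unfolding order using unitary_group.nat_pow_one by simp
  then have "A [^]\<^bsub>unitary_group\<^esub> (CARD('m) * (n div CARD('m))) = mat 1"
    using A by (simp add: unitary_group.nat_pow_pow)
  then have "A [^]\<^bsub>unitary_group\<^esub> n = A [^]\<^bsub>unitary_group\<^esub> (n mod CARD('m))"
    using A unitary_group.nat_pow_mult [of A "CARD('m) * (n div CARD('m))" "n mod CARD('m)"] by simp
  then show ?thesis
    by (simp add: mod_pow_def to_int_mod_ring_of_nat)
qed

lemma mod_pow_add_1: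
  assumes A: "unitary A" and order: "A [^]\<^bsub>unitary_group\<^esub> CARD('m) = mat 1"
  shows "mod_pow A (t + 1 :: 'm::nontriv mod_ring) = A ** mod_pow A t"
proof -
  obtain n where t: "t = of_nat n"
    by (metis of_nat_nat_to_int)
  have "A ** A [^]\<^bsub>unitary_group\<^esub> n = A [^]\<^bsub>unitary_group\<^esub> n ** A"
    by (rule unitary_group_pow_commute [symmetric]) simp
  moreover have "of_nat n + 1 = (of_nat (Suc n) :: 'm mod_ring)"
    by simp
  ultimately show ?thesis
    unfolding t using mod_pow_of_nat [OF A order, of n] mod_pow_of_nat [OF A order, of "Suc n"]
    by (simp del: of_nat_Suc)
qed

lemma mod_pow_0 [simp]: "mod_pow A 0 = mat 1"
  by (simp add: mod_pow_def)

lemma unitary_mod_pow [simp]: "unitary A \<Longrightarrow> unitary (mod_pow A t)"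
  by (simp add: mod_pow_def)

lemma mod_pow_commute: "A ** B = B ** A \<Longrightarrow> mod_pow A t ** B = B ** mod_pow A t"
  by (simp add: mod_pow_def unitary_group_pow_commute)

lemma mod_pow_commute_both: "A ** B = B ** A \<Longrightarrow> mod_pow A t ** mod_pow B u = mod_pow B u ** mod_pow A t"
  by (simp add: mod_pow_def unitary_group_pow_commute_both)

lemma mod_pow_shift:
  assumes "Z ** X = cscale (omega TYPE('m)) (X ** Z)"
  shows "Z ** mod_pow X (t :: 'm::nontriv mod_ring) = cscale (chi t) (mod_pow X t ** Z)"
proof -
  have "Z ** X [^]\<^bsub>unitary_group\<^esub> n = cscale (omega TYPE('m) ^ n) (X [^]\<^bsub>unitary_group\<^esub> n ** Z)" for n :: nat
  proof (induction n)
    case (Suc n)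
    have "Z ** X [^]\<^bsub>unitary_group\<^esub> Suc n = (Z ** X [^]\<^bsub>unitary_group\<^esub> n) ** X"
      by (simp add: matrix_mul_assoc)
    also have "\<dots> = cscale (omega TYPE('m) ^ n) (X [^]\<^bsub>unitary_group\<^esub> n ** (Z ** X))"
      by (simp add: Suc flip: matrix_mul_assoc)
    finally show ?case
      by (simp add: assms matrix_mul_assoc mult.commute)
  qed simp
  then show ?thesis
    by (simp add: mod_pow_def chi_def)
qed

text \<open>The \<open>m\<close>-th power annihilates both exponent vectors and leaves a phase
  \<open>e\<close>; an \<open>m\<close>-th root of its inverse is the required factor.\<close>

lemma is_pauli_normalise:
  fixes p :: "('n::finite, 'm::nontriv) op"
  assumes "is_pauli p"
  shows "\<exists>d. cmod d = 1 \<and> (cscale d p) [^]\<^bsub>unitary_group\<^esub> CARD('m) = mat 1"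
proof -
  obtain c a b where p: "cmod c = 1" "p = cscale c (weyl a b)"
    using assms by (rule is_pauliE)
  have "\<exists>e. cmod e = 1 \<and> p [^]\<^bsub>unitary_group\<^esub> n = cscale e (weyl (\<lambda>i. of_nat n * a i) (\<lambda>i. of_nat n * b i))" for n :: nat
  proof (induction n)
    case 0
    then show ?case
      by (intro exI [of _ 1]) (simp flip: zero_fun_def)
  next
    case (Suc n)
    then obtain e where e: "cmod e = 1"
      "p [^]\<^bsub>unitary_group\<^esub> n = cscale e (weyl (\<lambda>i. of_nat n * a i) (\<lambda>i. of_nat n * b i))"
      by blast
    let ?k = "chi (dot (\<lambda>i. of_nat n * b i) a)"
    have sum: "(\<lambda>i. of_nat n * x i) + x = (\<lambda>i. of_nat (Suc n) * x i)" for x :: "'n \<Rightarrow> 'm mod_ring"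
      by (simp add: plus_fun_def algebra_simps)
    have "p [^]\<^bsub>unitary_group\<^esub> Suc n = cscale (c * e * ?k) (weyl (\<lambda>i. of_nat (Suc n) * a i) (\<lambda>i. of_nat (Suc n) * b i))"
      unfolding sum [symmetric] unitary_group.nat_pow_Suc e(2)
      by (simp add: p(2) weyl_mult mult_ac)
    then show ?case
      using e(1) p(1) by (intro exI [of _ "c * e * ?k"]) (simp add: norm_mult)
  qed
  from this [of "CARD('m)"] obtain e where e: "cmod e = 1" "p [^]\<^bsub>unitary_group\<^esub> CARD('m) = cscale e (mat 1)"
    by (auto simp flip: zero_fun_def)
  define d where "d = cis (- Arg e / real CARD('m))"
  have "d ^ CARD('m) = cis (- Arg e)"
    by (simp add: d_def Complex.DeMoivre)
  moreover have "e = cis (Arg e)"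
    using rcis_cmod_Arg [of e] e(1) by (simp add: rcis_def)
  then have "cis (- Arg e) * e = 1"
    by (metis cis_mult add.left_inverse cis_zero)
  ultimately have "(cscale d p) [^]\<^bsub>unitary_group\<^esub> CARD('m) = mat 1"
    by (simp add: cscale_pow e(2))
  then show ?thesis
    by (intro exI [of _ d]) (simp add: d_def)
qed

text \<open>The exact relations of \<open>pauli_X\<close> and \<open>pauli_Z\<close> on the
  \<open>k\<close> logical qudits, including the orders. They are what remains of the logical
  generators once the phases have been normalised.\<close>

locale weyl_pairs =
  fixes X Z :: "'k::finite \<Rightarrow> ('n::finite, 'm::nontriv) op"
  assumes unitary_X [simp]: "unitary (X i)" and unitary_Z [simp]: "unitary (Z i)"
    and X_order: "X i [^]\<^bsub>unitary_group\<^esub> CARD('m) = mat 1"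
    and Z_order: "Z i [^]\<^bsub>unitary_group\<^esub> CARD('m) = mat 1"
    and X_commute: "X i ** X j = X j ** X i"
    and Z_commute: "Z i ** Z j = Z j ** Z i"
    and XZ_commute: "i \<noteq> j \<Longrightarrow> X i ** Z j = Z j ** X i"
    and ZX: "Z i ** X i = cscale (omega TYPE('m)) (X i ** Z i)"
begin

text \<open>A fixed vector of all \<open>Z i\<close> is found by projecting onto an eigenspace of each \<open>Z i\<close> in turn and
  shifting the eigenvalue to 1 with a power of \<open>X i\<close>.\<close>

lemma Z_fixed_step:
  assumes "v \<noteq> 0"
  obtains A where "A *v v \<noteq> 0" "Z i *v (A *v v) = A *v v"
    "\<And>B. B ** X i = X i ** B \<Longrightarrow> B ** Z i = Z i ** B \<Longrightarrow> B ** A = A ** B"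
proof -
  \<comment> \<open>Up to the factor \<open>m\<close>, \<open>E y\<close> is the Fourier projector
    onto the eigenspace of \<open>Z i\<close> with eigenvalue \<open>chi y\<close>.\<close>
  define E where "E y = (\<Sum>t\<in>UNIV. cscale (chi (- (y * t))) (mod_pow (Z i) t))" for y :: "'m mod_ring"
  have ZE: "Z i ** E y = cscale (chi y) (E y)" for y
  proof -
    have "Z i ** E y = (\<Sum>t\<in>UNIV. cscale (chi (- (y * t))) (mod_pow (Z i) (t + 1)))"
      by (simp add: E_def mult_sum_matrix mod_pow_add_1 Z_order)
    also have "\<dots> = (\<Sum>t\<in>UNIV. cscale (chi (- (y * (t - 1)))) (mod_pow (Z i) t))"
      by (rule sum.reindex_bij_witness [of _ "\<lambda>t. t - 1" "\<lambda>t. t + 1"]) auto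
    also have "\<dots> = cscale (chi y) (E y)"
    proof (rule matrix_eqI)
      fix f g
      have "chi (- (y * (t - 1))) = chi y * chi (- (y * t))" for t
        by (simp add: algebra_simps flip: chi_add)
      then show "(\<Sum>t\<in>UNIV. cscale (chi (- (y * (t - 1)))) (mod_pow (Z i) t)) $ f $ g = cscale (chi y) (E y) $ f $ g"
        by (simp add: E_def sum_distrib_left mult.assoc)
    qed
    finally show ?thesis .
  qed
  have sum_E: "(\<Sum>y\<in>UNIV. E y) = cscale (of_nat CARD('m)) (mat 1)"
  proof (rule matrix_eqI)
    fix f g
    have "(\<Sum>y\<in>UNIV. E y) $ f $ g
        = (\<Sum>t\<in>UNIV. (\<Sum>y\<in>UNIV. chi (y * - t)) * mod_pow (Z i) (t :: 'm mod_ring) $ f $ g)"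
      by (simp add: E_def sum_distrib_right) (rule sum.swap)
    also have "\<dots> = (\<Sum>t\<in>UNIV. if t = (0 :: 'm mod_ring) then of_nat CARD('m) * (mat 1 :: ('n, 'm) op) $ f $ g else 0)"
      by (rule sum.cong) (simp_all only: sum_chi, auto)
    finally show "(\<Sum>y\<in>UNIV. E y) $ f $ g = cscale (of_nat CARD('m)) (mat 1) $ f $ g"
      by simp
  qed
  \<comment> \<open>The projectors add up to a nonzero multiple of the identity, so not all of them
    can annihilate \<open>v\<close>.\<close>
  obtain y where y: "E y *v v \<noteq> 0"
  proof (rule ccontr)
    assume "\<not> thesis"
    then have "E y *v v = 0" for y
      using that by blast
    moreover have "(\<Sum>y\<in>UNIV. E y) *v v = (\<Sum>y\<in>UNIV. E y *v v)"
      by (simp add: vec_eq_iff matrix_vector_mult_def sum_distrib_right) (auto intro: sum.swap)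
    ultimately have "of_nat CARD('m) *s v = 0"
      unfolding sum_E by simp
    with \<open>v \<noteq> 0\<close> show False
      by simp
  qed
  let ?A = "mod_pow (X i) (- y) ** E y"
  have "Z i ** ?A = cscale (chi (- y)) (mod_pow (X i) (- y) ** (Z i ** E y))"
    by (simp add: mod_pow_shift [OF ZX] matrix_mul_assoc)
  then have "Z i ** ?A = ?A"
    by (simp add: ZE flip: chi_add)
  then have fixed: "Z i *v (?A *v v) = ?A *v v"
    by (simp add: matrix_vector_mul_assoc)
  have nonzero: "?A *v v \<noteq> 0"
  proof
    assume "?A *v v = 0"
    then have "(dagger (mod_pow (X i) (- y)) ** ?A) *v v = 0"
      by (metis matrix_vector_mul_assoc matrix_vector_mult_0_right)
    with y show False by simp
  qed
  have commute: "B ** ?A = ?A ** B" if "B ** X i = X i ** B" "B ** Z i = Z i ** B" for B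
  proof -
    have "B ** E y = E y ** B"
      using that by (simp add: E_def mult_sum_matrix sum_mult_matrix mod_pow_commute)
    moreover have "mod_pow (X i) (- y) ** B = B ** mod_pow (X i) (- y)"
      using that by (simp add: mod_pow_commute)
    ultimately show ?thesis
      by (simp add: commute_mult)
  qed
  show ?thesis
    by (rule that [OF nonzero fixed]) (rule commute)
qed

text \<open>The operator applied for \<open>i\<close> commutes with everything that commutes with
  \<open>X i\<close> and \<open>Z i\<close>. So it preserves the equations already won for other
  \<open>Z j\<close> and for \<open>S\<close>.\<close>

lemma Z_fixed_vector:
  assumes "v \<noteq> 0" "\<And>s. s \<in> S \<Longrightarrow> s *v v = v"
    and "\<And>s i. s \<in> S \<Longrightarrow> s ** X i = X i ** s \<and> s ** Z i = Z i ** s"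
  obtains w where "w \<noteq> 0" "\<And>i. Z i *v w = w" "\<And>s. s \<in> S \<Longrightarrow> s *v w = w"
proof -
  have "\<exists>w. w \<noteq> 0 \<and> (\<forall>i\<in>F. Z i *v w = w) \<and> (\<forall>s\<in>S. s *v w = w)" if "finite F" for F
    using that
  proof (induction F)
    case empty
    then show ?case
      using assms(1,2) by blast
  next
    case (insert i F)
    then obtain w where w: "w \<noteq> 0" "\<forall>i\<in>F. Z i *v w = w" "\<forall>s\<in>S. s *v w = w"
      by blast
    obtain A where A: "A *v w \<noteq> 0" "Z i *v (A *v w) = A *v w"
      "\<And>B. B ** X i = X i ** B \<Longrightarrow> B ** Z i = Z i ** B \<Longrightarrow> B ** A = A ** B"
      using Z_fixed_step [OF w(1)] by metis
    have fixed: "B *v (A *v w) = A *v w" if "B ** X i = X i ** B" "B ** Z i = Z i ** B" "B *v w = w" for B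
      using A(3) [OF that(1,2)] that(3) by (metis matrix_vector_mul_assoc)
    have "Z j *v (A *v w) = A *v w" if "j \<in> F" for j
      using fixed [of "Z j"] XZ_commute [of i j] Z_commute w(2) that insert.hyps by fastforce
    moreover have "s *v (A *v w) = A *v w" if "s \<in> S" for s
      using fixed [of s] assms(3) w(3) that by blast
    ultimately show ?case
      using A by (intro exI [of _ "A *v w"]) auto
  qed
  from this [of UNIV] show ?thesis
    using that by auto
qed

text \<open>The shift by a multi-index: it moves the reference vector \<open>w\<close>, in the role
  of basis label 0, to the label \<open>f\<close>.\<close>

definition XX :: "('k \<Rightarrow> 'm mod_ring) \<Rightarrow> ('n, 'm) op" where
  "XX f = comm_prod (\<lambda>i. mod_pow (X i) (f i)) UNIV"

lemma X_factors_commute: "mod_pow (X i) t ** mod_pow (X j) u = mod_pow (X j) u ** mod_pow (X i) t"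
  by (rule mod_pow_commute_both) (rule X_commute)

lemma XX_split: "XX f = mod_pow (X i) (f i) ** comm_prod (\<lambda>j. mod_pow (X j) (f j)) (UNIV - {i})"
proof -
  have "insert i (UNIV - {i}) = UNIV"
    by auto
  moreover have "comm_prod (\<lambda>j. mod_pow (X j) (f j)) (insert i (UNIV - {i}))
      = mod_pow (X i) (f i) ** comm_prod (\<lambda>j. mod_pow (X j) (f j)) (UNIV - {i})"
    by (rule comm_prod_insert) (auto intro: X_factors_commute)
  ultimately show ?thesis
    by (simp add: XX_def)
qed

lemma unitary_XX [simp]: "unitary (XX f)"
  unfolding XX_def by (rule comm_prod_unitary) (simp, rule X_factors_commute, simp)

lemma XX_commute:
  assumes "\<And>i. B ** X i = X i ** B"
  shows "B ** XX f = XX f ** B"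
  unfolding XX_def
  by (rule comm_prod_commute [symmetric])
    (simp, rule X_factors_commute, rule mod_pow_commute [OF assms [symmetric]])

lemma X_XX: "X i ** XX f = XX (f + unit_fun i 1)"
proof -
  have rest: "comm_prod (\<lambda>j. mod_pow (X j) ((f + unit_fun i 1) j)) (UNIV - {i})
      = comm_prod (\<lambda>j. mod_pow (X j) (f j)) (UNIV - {i})"
    by (rule comm_prod_cong) (simp, rule X_factors_commute, simp add: unit_fun_def)
  have "mod_pow (X i) ((f + unit_fun i 1) i) = X i ** mod_pow (X i) (f i)"
    by (simp add: unit_fun_def mod_pow_add_1 X_order)
  then show ?thesis
    unfolding XX_split [of "f + unit_fun i 1" i] XX_split [of f i] rest
    by (simp add: matrix_mul_assoc)
qed

lemma Z_XX: "Z i ** XX f = cscale (chi (f i)) (XX f ** Z i)"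
proof -
  let ?R = "comm_prod (\<lambda>j. mod_pow (X j) (f j)) (UNIV - {i})"
  have comm: "?R ** Z i = Z i ** ?R"
    by (rule comm_prod_commute) (simp, rule X_factors_commute, use XZ_commute in \<open>simp add: mod_pow_commute\<close>)
  have "Z i ** XX f = cscale (chi (f i)) (mod_pow (X i) (f i) ** (Z i ** ?R))"
    by (simp add: XX_split [of f i] mod_pow_shift [OF ZX] matrix_mul_assoc)
  then show ?thesis
    by (simp add: XX_split [of f i] matrix_mul_assoc flip: comm)
qed

text \<open>The columns imitate how the computational basis arises by shifts from a vector fixed by
  all \<open>Z\<close>. The Gram matrix commutes with every \<open>pauli_X i\<close> and
  \<open>pauli_Z i\<close>, so it is scalar and a rescaling turns \<open>V\<close> into an
  isometry.\<close>

lemma intertwining_isometry: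
  assumes "w \<noteq> 0" "\<And>i. Z i *v w = w" "\<forall>s\<in>S. s *v w = w"
    and "\<forall>s\<in>S. \<forall>i. s ** X i = X i ** s"
  shows "\<exists>V :: (('k, 'm) state, 'n \<Rightarrow> 'm mod_ring) vec. dagger V ** V = mat 1 \<and>
    (\<forall>i. X i ** V = V ** pauli_X i \<and> Z i ** V = V ** pauli_Z i) \<and> (\<forall>s\<in>S. s ** V = V)"
proof -
  define V where "V = (\<chi> x f. (XX f *v w) $ x)"
  have column: "(A ** V) $ x $ f = (A ** XX f *v w) $ x" for A :: "('n, 'm) op" and x f
    by (simp add: V_def mat_mult_nth matrix_vector_mult_def [of A] flip: matrix_vector_mul_assoc)
  have weyl_column: "(V ** weyl a b) $ x $ f = V $ x $ (f + a) * chi (dot b f)" for a b x f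
    by (rule mult_weyl_nth)
  have XV: "X i ** V = V ** pauli_X i" for i
    unfolding pauli_X_eq_weyl
    by (rule matrix_eqI) (simp add: column weyl_column X_XX, simp add: V_def)
  have ZV: "Z i ** V = V ** pauli_Z i" for i
    unfolding pauli_Z_eq_weyl
    by (rule matrix_eqI)
      (simp add: column weyl_column Z_XX assms(2) flip: matrix_vector_mul_assoc, simp add: V_def)
  have SV: "s ** V = V" if "s \<in> S" for s
    using XX_commute [of s] bspec [OF assms(3) that] bspec [OF assms(4) that]
    by (intro matrix_eqI) (simp add: column flip: matrix_vector_mul_assoc, simp add: V_def)
  have gram_commute: "(dagger V ** V) ** p = p ** (dagger V ** V)"
    if "U ** V = V ** p" "unitary U" "unitary p" for U p
  proof -
    have "dagger V ** U = p ** dagger V"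
      using arg_cong [OF intertwining_dagger [OF that], of dagger] by (simp add: dagger_mult)
    have "(dagger V ** V) ** p = dagger V ** (V ** p)"
      by (rule matrix_mul_assoc [symmetric])
    also have "\<dots> = (dagger V ** U) ** V"
      by (simp flip: that(1) add: matrix_mul_assoc)
    finally show ?thesis
      by (simp add: \<open>dagger V ** U = p ** dagger V\<close> flip: matrix_mul_assoc)
  qed
  have "acts_only_on {} (dagger V ** V)"
    by (rule acts_only_onI; rule gram_commute [OF XV] gram_commute [OF ZV]; simp)
  then obtain c where c: "dagger V ** V = cscale c (mat 1)"
    by (rule acts_only_on_empty)
  \<comment> \<open>The scalar is the squared norm of the column of label 0, hence real and
    positive, so its square root can be divided out.\<close>
  define r where "r = (\<Sum>x\<in>UNIV. (cmod (V $ x $ 0))\<^sup>2)"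
  have "c = (dagger V ** V) $ 0 $ 0"
    by (simp add: c mat_def)
  also have "\<dots> = of_real r"
    by (simp add: mat_mult_nth r_def complex_norm_square mult.commute del: of_real_power)
  finally have "c = of_real r" .
  have "r > 0"
  proof -
    have "XX 0 *v w \<noteq> 0"
    proof
      assume "XX 0 *v w = 0"
      then have "(dagger (XX 0) ** XX 0) *v w = 0"
        by (metis matrix_vector_mul_assoc matrix_vector_mult_0_right)
      with \<open>w \<noteq> 0\<close> show False by simp
    qed
    then obtain x where "V $ x $ 0 \<noteq> 0"
      by (auto simp: V_def vec_eq_iff)
    then have "0 < (cmod (V $ x $ 0))\<^sup>2"
      by simp
    also have "\<dots> \<le> r"
      unfolding r_def by (rule member_le_sum) auto
    finally show ?thesis .
  qed
  define V' where "V' = cscale (of_real (1 / sqrt r)) V"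
  have "1 / sqrt r * (1 / sqrt r) * r = 1"
    using \<open>r > 0\<close> by simp
  from arg_cong [OF this, of complex_of_real]
  have "of_real (1 / sqrt r) * of_real (1 / sqrt r) * c = 1"
    unfolding \<open>c = of_real r\<close> of_real_mult of_real_1 .
  then have "dagger V' ** V' = mat 1"
    by (simp add: V'_def c)
  then show ?thesis
    by (intro exI [of _ V']) (simp add: V'_def XV ZV SV)
qed

end

text \<open>An isometry is injective, so its range has full dimension and fills \<open>C\<close>.
  Through this the dimension clause of a stabilizer code yields surjectivity onto the code
  space.\<close>

lemma range_eq_if_dim_le:
  fixes V :: "complex ^ 'a ^ 'b"
  assumes "dagger V ** V = mat 1" "vec.subspace C" "range ((*v) V) \<subseteq> C" "vec.dim C \<le> CARD('a)"
  shows "range ((*v) V) = C"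
proof (rule vec.subspace_dim_equal)
  show "vec.subspace (range ((*v) V))"
    unfolding vec.subspace_def
  proof (intro conjI ballI allI)
    show "0 \<in> range ((*v) V)"
      by (rule range_eqI [of _ _ 0]) simp
    show "x + y \<in> range ((*v) V)" if "x \<in> range ((*v) V)" "y \<in> range ((*v) V)" for x y
      using that by (auto simp flip: matrix_vector_right_distrib)
    show "c *s x \<in> range ((*v) V)" if "x \<in> range ((*v) V)" for c x
      using that by (auto simp flip: vec.scale matrix_vector_mult_scaleR)
  qed
  have "inj ((*v) V)"
    by (rule inj_on_inverseI [of _ "(*v) (dagger V)"]) (simp add: matrix_vector_mul_assoc assms(1))
  then have "vec.dim (range ((*v) V)) = vec.dim (UNIV :: (complex ^ 'a) set)"
    by (intro vec.dim_image_eq) auto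
  then show "vec.dim C \<le> vec.dim (range ((*v) V))"
    using assms(4) unfolding vec_dim_card by simp
qed (use assms in auto)

lemma subspace_code_space: "vec.subspace (code_space S)"
  unfolding vec.subspace_def code_space_def
  by (auto simp: matrix_vector_right_distrib vector_scalar_commute)

context logical_code
begin

text \<open>The normalising phases give exact Weyl pairs, and undoing them at the end yields just
  the phases that an identification permits.\<close>

lemma logical_identification_exists: "\<exists>V. logical_identification S Xbar Zbar V"
proof -
  have "\<forall>i. \<exists>d. cmod d = 1 \<and> (cscale d (Xbar i)) [^]\<^bsub>unitary_group\<^esub> CARD('m) = mat 1"
    "\<forall>i. \<exists>d. cmod d = 1 \<and> (cscale d (Zbar i)) [^]\<^bsub>unitary_group\<^esub> CARD('m) = mat 1"
    by (simp_all add: is_pauli_normalise)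
  then obtain x z where
    x: "\<And>i. cmod (x i) = 1" "\<And>i. (cscale (x i) (Xbar i)) [^]\<^bsub>unitary_group\<^esub> CARD('m) = mat 1" and
    z: "\<And>i. cmod (z i) = 1" "\<And>i. (cscale (z i) (Zbar i)) [^]\<^bsub>unitary_group\<^esub> CARD('m) = mat 1"
    unfolding choice_iff by blast
  define X where "X i = cscale (x i) (Xbar i)" for i
  define Z where "Z i = cscale (z i) (Zbar i)" for i
  interpret weyl_pairs X Z
  proof
    fix i
    have "gcomm (Xbar i) (Zbar i) = cscale (inverse (omega TYPE('m))) (mat 1)"
      using gens by (simp add: logical_pauli_generators_def flip: mat_eq_cscale)
    then have "Xbar i ** Zbar i = cscale (inverse (omega TYPE('m))) (Zbar i ** Xbar i)"
      by (intro commutation_if_gcomm_scalar) auto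
    moreover have "omega TYPE('m) \<noteq> 0"
      by (simp add: omega_def)
    ultimately show "Z i ** X i = cscale (omega TYPE('m)) (X i ** Z i)"
      by (simp add: X_def Z_def field_simps)
  qed (use x z in \<open>simp_all add: X_def Z_def gens_commute mult.commute\<close>)
  have comm: "s ** X i = X i ** s \<and> s ** Z i = Z i ** s" if "s \<in> S" for s i
    using gens_commute_S [OF that] by (simp add: X_def Z_def)
  have dim: "vec.dim (code_space S) = CARD('m) ^ CARD('k)"
    using code by (simp add: stabilizer_code_def)
  \<comment> \<open>The positive dimension provides the nonzero code vector from which the common
    fixed vector is made.\<close>
  then have "\<not> code_space S \<subseteq> {0}"
    using vec.dim_eq_0 [of "code_space S"] by simp
  then obtain v where v: "v \<noteq> 0" "v \<in> code_space S"
    by auto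
  have v_fixed: "s *v v = v" if "s \<in> S" for s
    using v(2) that by (simp add: code_space_def)
  obtain w where w: "w \<noteq> 0" "\<And>i. Z i *v w = w" "\<And>s. s \<in> S \<Longrightarrow> s *v w = w"
    using Z_fixed_vector [OF v(1) v_fixed comm] by metis
  have "\<forall>s\<in>S. s *v w = w" "\<forall>s\<in>S. \<forall>i. s ** X i = X i ** s"
    using w(3) comm by auto
  from intertwining_isometry [OF w(1,2) this]
  obtain V :: "(('k, 'm) state, 'n \<Rightarrow> 'm mod_ring) vec"
    where V: "dagger V ** V = mat 1" "\<And>i. X i ** V = V ** pauli_X i"
      "\<And>i. Z i ** V = V ** pauli_Z i" "\<And>s. s \<in> S \<Longrightarrow> s ** V = V"
    by blast
  have "range ((*v) V) = code_space S"
  proof (rule range_eq_if_dim_le [OF V(1) subspace_code_space])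
    show "range ((*v) V) \<subseteq> code_space S"
      by (auto simp: code_space_def matrix_vector_mul_assoc V(4))
    show "vec.dim (code_space S) \<le> CARD('k \<Rightarrow> 'm mod_ring)"
      by (simp add: dim card_fun)
  qed
  moreover have "Xbar i = cscale (cnj (x i)) (X i)" "Zbar i = cscale (cnj (z i)) (Z i)" for i
    by (simp_all add: X_def Z_def x z)
  then have "Xbar i ** V = mat (cnj (x i)) ** V ** pauli_X i"
    "Zbar i ** V = mat (cnj (z i)) ** V ** pauli_Z i" for i
    by (simp_all add: V)
  then have "\<exists>c. cmod c = 1 \<and> Xbar i ** V = mat c ** V ** pauli_X i"
    "\<exists>c. cmod c = 1 \<and> Zbar i ** V = mat c ** V ** pauli_Z i" for i
    using x(1) z(1) by (metis complex_mod_cnj)+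
  ultimately show ?thesis
    using V(1) unfolding logical_identification_def by blast
qed

end

theorem theorem9:
  fixes withY :: bool
    and S :: "('n::finite, 'm::nontriv) op set"
    and Xbar Zbar :: "'k::finite \<Rightarrow> ('n, 'm) op"
    and Q :: "'n set set"
    and q h M :: nat
  defines "L \<equiv> nontrivial_logical_paulis S Xbar Zbar"
  assumes "stabilizer_code withY CARD('k) S"
    and "logical_pauli_generators withY S Xbar Zbar"
    and "partition_on UNIV Q"
    and "q \<ge> 1" and "h \<ge> 1" and "M \<ge> 1"
    and "real (max_distance Q L) * real q ^ ((2 ^ M - 1) * h)
           < real (min_distance Q L) * disjointness Q L ^ (M - 1)"
  shows "\<forall>U. logical_operator S U \<and> local_circuit Q q h U
           \<longrightarrow> U \<in> logical_clifford withY S Xbar Zbar M"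
proof -
  interpret logical_code withY S Xbar Zbar
    by unfold_locales (use assms(2,3) in auto)
  show ?thesis
    using logical_identification_exists local_circuit_clifford [OF _ assms(4,7) assms(8) [unfolded L_def]]
    unfolding logical_clifford_def by blast
qed

end
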